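(* Let $\rho_-,\rho_+:[0,\infty)\to(0,1)$ be differentiable with bounded derivative. For each $N$ let $(\eta_t)_{t\ge0}$ be the time-inhomogeneous Markov process on $\{0,1\}^{\Lambda_N}$, $\Lambda_N=\{-N,\dots,N\}$, with generator $L_{N,t}=N^{2+\alpha}[L_{\mathrm{exc}}+L_{b,t}]$ at time $t$ (defined in the context). Then for any $\alpha>0$, any $t>0$, any initial configurations $\eta_0=\eta_0^N$, any local function $\varphi$ and any continuous function $G:[-1,1]\to\mathbb R$, $$\lim_{N\to\infty}\mathbb E_{\eta_0}\left(\int_0^t ds\,\left|\frac1N\sum_x G\Big(\frac xN\Big)\theta_x\varphi(\eta_s)-\int_{-1}^1 G(y)\,\hat\varphi(\bar\rho(y,s))\,dy\right|\right)=0,$$ where $\bar\rho(y,s)=\frac12[\rho_+(s)-\rho_-(s)]y+\frac12[\rho_+(s)+\rho_-(s)]$ and the sum runs over all $x\in\Lambda_N$ for which $\theta_x\varphi$ depends only on sites of $\Lambda_N$.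
   Context: For $f:\{0,1\}^{\Lambda_N}\to\mathbb R$, $$L_{\mathrm{exc}}f(\eta)=\frac12\sum_{x=-N}^{N-1}\big(f(\eta^{(x,x+1)})-f(\eta)\big),$$ where $\eta^{(x,y)}$ is obtained from $\eta$ by exchanging the occupation numbers at $x$ and $y$, and $$L_{b,t}f(\eta)=\sum_{\sigma=\pm}\rho_\sigma(t)^{1-\eta(\sigma N)}(1-\rho_\sigma(t))^{\eta(\sigma N)}\,[f(\eta^{\sigma N})-f(\eta)],$$ where $\eta^{x}(x)=1-\eta(x)$ and $\eta^x(y)=\eta(y)$ for $y\ne x$. $\mathbb E_{\eta_0}$ is expectation for the process started from $\eta_0$. A local function is a function on $\{0,1\}^{\mathbb Z}$ depending on finitely many occupation numbers; $\theta_x$ is the shift by $x$ (if $\varphi$ depends on $\eta(z)$, $z\in A$, then $\theta_x\varphi$ is the same function of $\eta(z+x)$, $z\in A$). $\hat\varphi(\rho)=\langle\varphi\rangle_\rho$ is the expectation of $\varphi$ with respect to the product Bernoulli measure with density $\rho$. *)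

theory Defs
  imports "HOL-Probability.Probability"
begin

text \<open>
  An occupation number is a boolean (\<open>True\<close> for 1, \<open>False\<close> for 0), so the space of
  configurations on all integer sites is the full type of functions from sites to booleans.
  Configurations on the box are the extensional functions on the box.
\<close>

type_synonym config = "int \<Rightarrow> bool"

definition box :: "nat \<Rightarrow> int set" where
  "box N = {- int N..int N}"

definition configs :: "nat \<Rightarrow> config set" where
  "configs N = (box N \<rightarrow>\<^sub>E UNIV)"

definition exchange :: "config \<Rightarrow> int \<Rightarrow> int \<Rightarrow> config" where
  "exchange \<eta> x y = \<eta>(x := \<eta> y, y := \<eta> x)"

definition flip :: "config \<Rightarrow> int \<Rightarrow> config" where
  "flip \<eta> x = \<eta>(x := \<not> \<eta> x)"

definition L_exc :: "nat \<Rightarrow> (config \<Rightarrow> real) \<Rightarrow> config \<Rightarrow> real" where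
  "L_exc N f \<eta> = 1 / 2 * (\<Sum>x = - int N..int N - 1. f (exchange \<eta> x (x + 1)) - f \<eta>)"

definition flip_rate :: "real \<Rightarrow> bool \<Rightarrow> real" where
  "flip_rate r b = r ^ (1 - of_bool b) * (1 - r) ^ of_bool b"

definition L_bdry :: "real \<Rightarrow> real \<Rightarrow> nat \<Rightarrow> (config \<Rightarrow> real) \<Rightarrow> config \<Rightarrow> real" where
  "L_bdry rm rp N f \<eta> =
     flip_rate rm (\<eta> (- int N)) * (f (flip \<eta> (- int N)) - f \<eta>) +
     flip_rate rp (\<eta> (int N)) * (f (flip \<eta> (int N)) - f \<eta>)"

definition gen ::
  "real \<Rightarrow> (real \<Rightarrow> real) \<Rightarrow> (real \<Rightarrow> real) \<Rightarrow> nat \<Rightarrow> real \<Rightarrow> (config \<Rightarrow> real) \<Rightarrow> config \<Rightarrow> real"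
where
  "gen \<alpha> \<rho>m \<rho>p N t f \<eta> =
     real N powr (2 + \<alpha>) * (L_exc N f \<eta> + L_bdry (\<rho>m t) (\<rho>p t) N f \<eta>)"

text \<open>
  Transition probabilities on a finite state space \<open>S\<close> whose generator at time \<open>t\<close> is \<open>L t\<close>.
  The last clause is the forward equation; at \<open>u = s\<close> it says that the right derivative of
  the transition operators at time \<open>s\<close> is \<open>L s\<close>. It is imposed as a two-sided derivative for
  later times because a one-sided one would permit additional jumps at deterministic times.
\<close>

definition transition_function ::
  "'a set \<Rightarrow> (real \<Rightarrow> ('a \<Rightarrow> real) \<Rightarrow> 'a \<Rightarrow> real) \<Rightarrow> (real \<Rightarrow> real \<Rightarrow> 'a \<Rightarrow> 'a pmf) \<Rightarrow> bool"
where
  "transition_function S L P \<longleftrightarrow>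
     (\<forall>s t. \<forall>x\<in>S. 0 \<le> s \<and> s \<le> t \<longrightarrow> set_pmf (P s t x) \<subseteq> S) \<and>
     (\<forall>s. \<forall>x\<in>S. 0 \<le> s \<longrightarrow> P s s x = return_pmf x) \<and>
     (\<forall>s t u. \<forall>x\<in>S. 0 \<le> s \<and> s \<le> t \<and> t \<le> u \<longrightarrow> P s u x = bind_pmf (P s t x) (P t u)) \<and>
     (\<forall>s u. \<forall>x\<in>S. \<forall>f. 0 \<le> s \<and> s \<le> u \<longrightarrow>
        ((\<lambda>r. measure_pmf.expectation (P s r x) f) has_real_derivative
           measure_pmf.expectation (P s u x) (L u f)) (at u within {s..}))"

definition natural_filtration :: "'w measure \<Rightarrow> (real \<Rightarrow> 'w \<Rightarrow> 'a) \<Rightarrow> real \<Rightarrow> 'w measure" where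
  "natural_filtration M X s =
     sigma (space M) {X u -` {a} \<inter> space M | u a. 0 \<le> u \<and> u \<le> s}"

text \<open>
  The Markov process on the finite set \<open>S\<close> with time-dependent generator \<open>L\<close>, started from
  \<open>x0\<close>. The two clauses with \<open>eventually\<close> say that the paths are right-continuous with left
  limits for the discrete topology on \<open>S\<close>; they make time integrals along paths measurable.
\<close>

definition markov_process ::
  "'a set \<Rightarrow> (real \<Rightarrow> ('a \<Rightarrow> real) \<Rightarrow> 'a \<Rightarrow> real) \<Rightarrow> 'a \<Rightarrow> 'w measure \<Rightarrow> (real \<Rightarrow> 'w \<Rightarrow> 'a) \<Rightarrow> bool"
where
  "markov_process S L x0 M X \<longleftrightarrow>
     prob_space M \<and>
     (\<forall>t\<ge>0. X t \<in> measurable M (count_space S)) \<and>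
     (AE \<omega> in M. X 0 \<omega> = x0) \<and>
     (\<forall>\<omega>\<in>space M. \<forall>t\<ge>0. eventually (\<lambda>s. X s \<omega> = X t \<omega>) (at_right t)) \<and>
     (\<forall>\<omega>\<in>space M. \<forall>t>0. \<exists>a\<in>S. eventually (\<lambda>s. X s \<omega> = a) (at_left t)) \<and>
     (\<exists>P. transition_function S L P \<and>
        (\<forall>s t. \<forall>y\<in>S. 0 \<le> s \<and> s \<le> t \<longrightarrow>
           (AE \<omega> in M. real_cond_exp M (natural_filtration M X s) (\<lambda>\<omega>. indicator {y} (X t \<omega>)) \<omega>
              = pmf (P s t (X s \<omega>)) y)))"

definition depends_only_on :: "(config \<Rightarrow> real) \<Rightarrow> int set \<Rightarrow> bool" where
  "depends_only_on \<phi> A \<longleftrightarrow> (\<forall>\<eta> \<zeta>. (\<forall>x\<in>A. \<eta> x = \<zeta> x) \<longrightarrow> \<phi> \<eta> = \<phi> \<zeta>)"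

definition local_function :: "(config \<Rightarrow> real) \<Rightarrow> bool" where
  "local_function \<phi> \<longleftrightarrow> (\<exists>A. finite A \<and> depends_only_on \<phi> A)"

definition shift :: "int \<Rightarrow> (config \<Rightarrow> real) \<Rightarrow> config \<Rightarrow> real" where
  "shift x \<phi> \<eta> = \<phi> (\<lambda>z. \<eta> (z + x))"

definition bernoulli_mean :: "(config \<Rightarrow> real) \<Rightarrow> real \<Rightarrow> real" where
  "bernoulli_mean \<phi> \<rho> = (\<integral>\<eta>. \<phi> \<eta> \<partial>(Pi\<^sub>M UNIV (\<lambda>_. measure_pmf (bernoulli_pmf \<rho>))))"

definition rho_bar :: "(real \<Rightarrow> real) \<Rightarrow> (real \<Rightarrow> real) \<Rightarrow> real \<Rightarrow> real \<Rightarrow> real" where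
  "rho_bar \<rho>m \<rho>p y s = 1 / 2 * (\<rho>p s - \<rho>m s) * y + 1 / 2 * (\<rho>p s + \<rho>m s)"

definition empirical_average ::
  "nat \<Rightarrow> (real \<Rightarrow> real) \<Rightarrow> (config \<Rightarrow> real) \<Rightarrow> config \<Rightarrow> real"
where
  "empirical_average N G \<phi> \<eta> =
     1 / real N * (\<Sum>x\<in>{x \<in> box N. depends_only_on (shift x \<phi>) (box N)}.
                     G (real_of_int x / real N) * shift x \<phi> \<eta>)"

end

(*
  Products of occupation numbers are duality functions: the expectations u(C) of prod_{x in C} eta(x)
  solve a closed cooperative system of ODEs, in which C moves as an exclusion process whose particles
  are removed at the end points with the weights rho_-, rho_+. The product v(C) of the linear
  stationary profile solves the same system up to an error of order N^alpha times the number of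
  adjacent pairs in C (v is not invariant under exclusion) plus the bounded term dv/dt. Explicit
  supersolutions absorb both errors and the initial condition: a concave quadratic function of the
  positions for the bounded term and the initial condition, and minus the sum of the mutual distances,
  which is only of order N, for the adjacent pairs. The comparison principle then gives u - v -> 0
  uniformly in C at every fixed positive time. This factorisation makes the variance of the spatial
  averages vanish, first for products and then, by linearity, for all local functions; dominated
  convergence in time concludes.
*)
theory Submission
  imports Defs "HOL-Real_Asymp.Real_Asymp"
begin

section \<open>A comparison principle for cooperative systems\<close>

text \<open>The stationary profile has slope of order 1/N, so its product fails to be invariant by
  order 1/N^2 per adjacent pair. After the acceleration by N^(2 + \<alpha>) this diverges, and an
  estimate that ignores the motion of the particles is useless. The remedy is that adjacency is
  rare: exclusion makes the total distance drift by +1 per adjacent pair, while no distance exceeds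
  2N. The defect thus costs N^(-2) times order N, that is 1/N, whatever \<alpha> is. The assumption
  \<alpha> > 0 enters in the two other errors. The quadratic function is of order N^2 and gets
  divided by N^(2 + \<alpha>), and the initial discrepancy is forgotten at a rate of order
  N^\<alpha>. Nothing is gained at time 0, so the estimate is useful at fixed positive times only.
  The dual moves never increase the number of particles. Hence the sets with at most K elements form
  a closed finite system, and every constant may depend on K.\<close>

text \<open>Consider the first time at which some component is not positive. By continuity all
  components are nonnegative there and one vanishes, so \<open>touch\<close> makes its derivative
  positive; it was then negative just before, against minimality. The strict inequality in
  \<open>touch\<close> is the reason for the surplus 1 in the supersolution below.\<close>

lemma finite_system_positive:
  fixes z z' :: "'i \<Rightarrow> real \<Rightarrow> real"
  assumes "finite I"
    and deriv: "\<And>i s. i \<in> I \<Longrightarrow> 0 \<le> s \<Longrightarrow> (z i has_real_derivative z' i s) (at s within {0..})"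
    and init: "\<And>i. i \<in> I \<Longrightarrow> 0 < z i 0"
    and touch: "\<And>i s. i \<in> I \<Longrightarrow> 0 \<le> s \<Longrightarrow> z i s = 0 \<Longrightarrow> (\<And>j. j \<in> I \<Longrightarrow> 0 \<le> z j s) \<Longrightarrow> 0 < z' i s"
    and "i \<in> I" "0 \<le> s"
  shows "0 < z i s"
proof (rule ccontr)
  assume neg: "\<not> 0 < z i s"
  define S where "S = (\<Union>i\<in>I. {0..} \<inter> z i -` {..0})"
  have cont: "continuous_on {0..} (z j)" if "j \<in> I" for j
    using deriv[OF that] by (intro DERIV_continuous_on) auto
  have "closed S"
    unfolding S_def using \<open>finite I\<close> cont
    by (intro closed_UN) (auto intro!: continuous_closed_preimage)
  moreover have "s \<in> S" using neg assms(5,6) by (auto simp: S_def not_less)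
  moreover have bdd: "bdd_below S" by (rule bdd_belowI[of _ 0]) (auto simp: S_def)
  ultimately have "Inf S \<in> S" using closed_contains_Inf by blast
  define \<tau> where "\<tau> = Inf S"
  have tS: "\<tau> \<in> S" using \<open>Inf S \<in> S\<close> by (simp add: \<tau>_def)
  then obtain k where k: "k \<in> I" "0 \<le> \<tau>" "z k \<tau> \<le> 0" by (auto simp: S_def)
  have before: "0 < z j r" if "j \<in> I" "0 \<le> r" "r < \<tau>" for j r
  proof (rule ccontr)
    assume "\<not> 0 < z j r"
    then have "r \<in> S" using that by (auto simp: S_def not_less)
    then have "\<tau> \<le> r" unfolding \<tau>_def using bdd by (rule cInf_lower)
    with that show False by simp
  qed
  have tpos: "0 < \<tau>" using k init[OF k(1)] by (cases "\<tau> = 0") auto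
  have nonneg: "0 \<le> z j \<tau>" if j: "j \<in> I" for j
  proof (rule ccontr)
    assume n: "\<not> 0 \<le> z j \<tau>"
    have "continuous_on {0..\<tau>} (z j)" by (rule continuous_on_subset[OF cont[OF j]]) auto
    then obtain r where r: "0 \<le> r" "r \<le> \<tau>" "z j r = 0"
      using IVT2'[of "z j" \<tau> 0 0] n init[OF j] tpos by auto
    then have "r < \<tau>" using n by (cases "r = \<tau>") auto
    with before[OF j r(1)] r show False by simp
  qed
  have "z k \<tau> = 0" using nonneg[OF k(1)] k(3) by simp
  then have "0 < z' k \<tau>" using touch k nonneg by blast
  then obtain d where d: "d > 0" "\<And>h. h > 0 \<Longrightarrow> \<tau> - h \<in> {0..} \<Longrightarrow> h < d \<Longrightarrow> z k (\<tau> - h) < z k \<tau>"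
    using has_real_derivative_pos_inc_left[OF deriv[OF k(1,2)]] by blast
  \<comment> \<open>Half of \<open>d\<close> stays inside the range of the derivative estimate, and
    the cap at \<open>\<tau>\<close> keeps the earlier time nonnegative.\<close>
  define h where "h = min (d/2) \<tau>"
  have "z k (\<tau> - h) < 0" using d tpos \<open>z k \<tau> = 0\<close> by (auto simp: h_def min_def)
  moreover have "0 < z k (\<tau> - h)" using before[OF k(1), of "\<tau> - h"] d tpos by (auto simp: h_def min_def)
  ultimately show False by simp
qed

section \<open>Duality\<close>

definition mon :: "int set \<Rightarrow> config \<Rightarrow> real" where
  "mon C \<eta> = of_bool (\<forall>y\<in>C. \<eta> y)"

text \<open>An end particle is removed at rate 1 and the value after the removal is weighted by the
  reservoir density. The boundary part is therefore not a multiple of a difference, and constants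
  are not annihilated.\<close>

definition dual_gen :: "real \<Rightarrow> real \<Rightarrow> nat \<Rightarrow> (int set \<Rightarrow> real) \<Rightarrow> int set \<Rightarrow> real" where
  "dual_gen rm rp N f C =
     1 / 2 * (\<Sum>x = - int N..int N - 1. f (Transposition.transpose x (x + 1) ` C) - f C) +
     ((if - int N \<in> C then rm * f (C - {- int N}) - f C else 0) +
      (if int N \<in> C then rp * f (C - {int N}) - f C else 0))"

lemma mon_Un: "mon (C \<union> C') \<eta> = mon C \<eta> * mon C' \<eta>"
  by (auto simp: mon_def)

lemma mon_empty [simp]: "mon {} = (\<lambda>_. 1)"
  by (simp add: mon_def fun_eq_iff)

lemma mon_bounds: "0 \<le> mon C \<eta>" "mon C \<eta> \<le> 1"
  by (auto simp: mon_def)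

lemma exchange_eq_transpose: "exchange \<eta> x y = (\<lambda>z. \<eta> (Transposition.transpose x y z))"
  by (auto simp: exchange_def transpose_def fun_eq_iff)

lemma mon_exchange: "mon C (exchange \<eta> x y) = mon (Transposition.transpose x y ` C) \<eta>"
  by (auto simp: mon_def exchange_eq_transpose)

text \<open>The boundary generator sends the occupation number at \<open>x\<close> to
  \<open>r\<close> minus itself: an empty site fills at rate \<open>r\<close>, a full one empties at
  rate \<open>1 - r\<close>. The other factors of the product do not see the flip.\<close>

lemma mon_flip:
  "flip_rate r (\<eta> x) * (mon C (flip \<eta> x) - mon C \<eta>) =
     (if x \<in> C then r * mon (C - {x}) \<eta> - mon C \<eta> else 0)"
proof (cases "x \<in> C")
  case True
  then have "mon C \<zeta> = of_bool (\<zeta> x) * mon (C - {x}) \<zeta>" for \<zeta>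
    by (auto simp: mon_def)
  moreover have "mon (C - {x}) (flip \<eta> x) = mon (C - {x}) \<eta>"
    by (auto simp: mon_def flip_def)
  ultimately show ?thesis
    using True by (auto simp: flip_rate_def flip_def algebra_simps)
qed (auto simp: mon_def flip_def)

lemma gen_mon:
  "gen \<alpha> \<rho>m \<rho>p N t (mon C) \<eta> =
     real N powr (2 + \<alpha>) * dual_gen (\<rho>m t) (\<rho>p t) N (\<lambda>C. mon C \<eta>) C"
  by (simp add: gen_def L_exc_def L_bdry_def dual_gen_def mon_exchange mon_flip)

lemma dual_gen_add: "dual_gen rm rp N (\<lambda>C. f C + g C) C = dual_gen rm rp N f C + dual_gen rm rp N g C"
  by (simp add: dual_gen_def sum.distrib sum_subtractf algebra_simps)

lemma dual_gen_cmult: "dual_gen rm rp N (\<lambda>C. c * f C) C = c * dual_gen rm rp N f C"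
  by (simp add: dual_gen_def sum_subtractf sum_distrib_left algebra_simps)

lemma dual_gen_diff: "dual_gen rm rp N (\<lambda>C. f C - g C) C = dual_gen rm rp N f C - dual_gen rm rp N g C"
  using dual_gen_add[of rm rp N f "\<lambda>C. (-1) * g C" C] dual_gen_cmult[of rm rp N "-1" g C] by simp

lemma expectation_dual_gen:
  assumes "finite (set_pmf q)"
  shows "measure_pmf.expectation q (\<lambda>\<eta>. dual_gen rm rp N (\<lambda>C. mon C \<eta>) C) =
         dual_gen rm rp N (\<lambda>C. measure_pmf.expectation q (mon C)) C"
proof -
  have [simp]: "integrable (measure_pmf q) f" for f :: "config \<Rightarrow> real"
    using assms by (rule integrable_measure_pmf_finite)
  show ?thesis by (simp add: dual_gen_def)
qed

lemma transpose_Suc_image: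
  "Transposition.transpose x (x + 1 :: int) ` C =
     (if x \<in> C \<and> x + 1 \<notin> C then insert (x + 1) (C - {x})
      else if x \<notin> C \<and> x + 1 \<in> C then insert x (C - {x + 1}) else C)"
proof -
  have "y \<in> Transposition.transpose x (x + 1) ` C \<longleftrightarrow>
    (if y = x then x + 1 \<in> C else if y = x + 1 then x \<in> C else y \<in> C)" for y
    by (auto simp: Transposition.transpose_def image_iff)
  then show ?thesis
    by (intro set_eqI) (auto split: if_splits)
qed

text \<open>This is cooperativity. The coefficient of every \<open>f C'\<close> with C' different
  from C is nonnegative, the diagonal part vanishes with \<open>f C\<close>, and neither a swap nor
  a removal increases the cardinality or leaves the box.\<close>

lemma dual_gen_at_zero_nonneg:
  assumes "0 \<le> rm" "0 \<le> rp" "f C = 0" "C \<subseteq> box N"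
    and "\<And>C'. C' \<subseteq> box N \<Longrightarrow> card C' \<le> card C \<Longrightarrow> 0 \<le> f C'"
  shows "0 \<le> dual_gen rm rp N f C"
proof -
  have fin: "finite C" using assms(4) finite_subset unfolding box_def by blast
  have "0 \<le> f (Transposition.transpose x (x + 1) ` C)" if "x \<in> {- int N..int N - 1}" for x
  proof (rule assms(5))
    show "Transposition.transpose x (x + 1) ` C \<subseteq> box N"
      using assms(4) that by (auto simp: transpose_Suc_image box_def)
    show "card (Transposition.transpose x (x + 1) ` C) \<le> card C" using fin by (rule card_image_le)
  qed
  moreover have "0 \<le> f (C - {x})" for x
    by (rule assms(5)) (use assms(4) fin in \<open>auto intro: card_mono\<close>)
  ultimately show ?thesis
    using assms(1-3) by (auto simp: dual_gen_def intro!: add_nonneg_nonneg sum_nonneg)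
qed

lemma sum_int_telescope:
  fixes f :: "int \<Rightarrow> real"
  assumes "a \<le> b"
  shows "(\<Sum>x = a..b - 1. f (x + 1) - f x) = f b - f a"
  using assms
proof (induction b rule: int_ge_induct)
  case (step b)
  then have "{a..b + 1 - 1} = insert b {a..b - 1}" by auto
  then show ?case using step by simp
qed simp

section \<open>Supersolutions and the stationary profile\<close>

abbreviation occ :: "int set \<Rightarrow> int \<Rightarrow> real" where
  "occ C x \<equiv> of_bool (x \<in> C)"

definition adj :: "nat \<Rightarrow> int set \<Rightarrow> real" where
  "adj N C = (\<Sum>x = - int N..int N - 1. occ C x * occ C (x + 1))"

lemma finite_box [simp]: "finite (box N)"
  by (simp add: box_def)

lemma sum_swap:
  fixes h :: "int \<Rightarrow> real"
  assumes "finite C"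
  shows "(\<Sum>y\<in>Transposition.transpose x (x + 1) ` C. h y) - (\<Sum>y\<in>C. h y) =
           (occ C x - occ C (x + 1)) * (h (x + 1) - h x)"
  using assms by (auto simp: transpose_Suc_image sum_diff1)

lemma card_swap: "card (Transposition.transpose x y ` C) = card C"
  by (simp add: card_image)

text \<open>Bonds are indexed by their left end points, so the last site is not counted.\<close>

lemma sum_occ:
  assumes "C \<subseteq> box N"
  shows "(\<Sum>x = - int N..int N - 1. occ C x) = real (card C) - occ C (int N)"
proof -
  have "real (card C) = (\<Sum>x\<in>box N. occ C x)"
    using assms by (simp add: of_bool_def sum.If_cases Int_absorb1)
  also have "box N = insert (int N) {- int N..int N - 1}" by (auto simp: box_def)
  finally show ?thesis by simp
qed

section \<open>A concave quadratic supersolution\<close>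

text \<open>The second difference is -2. The constant keeps the values on the box between (N + 1)^2
  and twice that, so that the initial condition is dominated after division by (N + 1)^2, and makes
  the removal at an end outweigh the missing jump at the wall.\<close>

definition hfun :: "nat \<Rightarrow> int \<Rightarrow> real" where
  "hfun N y = 2 * (real N + 1)\<^sup>2 - (real_of_int y)\<^sup>2"

definition Hfun :: "nat \<Rightarrow> int set \<Rightarrow> real" where
  "Hfun N C = (\<Sum>y\<in>C. hfun N y)"

lemma hfun_bounds:
  assumes "y \<in> box N"
  shows "(real N + 1)\<^sup>2 \<le> hfun N y" "hfun N y \<le> 2 * (real N + 1)\<^sup>2"
proof -
  have "(real_of_int y)\<^sup>2 \<le> (real N)\<^sup>2"
    by (rule power2_le_iff_abs_le[THEN iffD2]) (use assms in \<open>auto simp: box_def\<close>)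
  then show "(real N + 1)\<^sup>2 \<le> hfun N y" by (simp add: hfun_def power2_eq_square algebra_simps)
qed (simp add: hfun_def)

lemma Hfun_bounds:
  assumes "C \<subseteq> box N"
  shows "real (card C) * (real N + 1)\<^sup>2 \<le> Hfun N C" "Hfun N C \<le> 2 * real (card C) * (real N + 1)\<^sup>2"
proof -
  show "real (card C) * (real N + 1)\<^sup>2 \<le> Hfun N C"
    unfolding Hfun_def using assms hfun_bounds(1) by (intro sum_bounded_below) auto
  have "Hfun N C \<le> real (card C) * (2 * (real N + 1)\<^sup>2)"
    unfolding Hfun_def using assms hfun_bounds(2) by (intro sum_bounded_above) auto
  then show "Hfun N C \<le> 2 * real (card C) * (real N + 1)\<^sup>2" by simp
qed

text \<open>An additive function does not feel the exclusion rule, since swapping two particles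
  changes nothing and the bond sum is linear in the occupation numbers. Summation by parts leaves
  half of the second difference, -1 per particle, and a wall term at each end, where one jump is
  missing.\<close>

lemma Hfun_bulk:
  assumes "C \<subseteq> box N"
  shows "1 / 2 * (\<Sum>x = - int N..int N - 1. Hfun N (Transposition.transpose x (x + 1) ` C) - Hfun N C)
    = (real N + 1 / 2) * (occ C (- int N) + occ C (int N)) - real (card C)"
proof -
  have fin: "finite C" using assms finite_subset finite_box by blast
  define T where "T x = (2 * real_of_int x - 1) * occ C x" for x
  have "Hfun N (Transposition.transpose x (x + 1) ` C) - Hfun N C = (T (x + 1) - T x) - 2 * occ C x" for x
    unfolding Hfun_def sum_swap[OF fin] by (simp add: T_def hfun_def power2_eq_square algebra_simps)
  then have "(\<Sum>x = - int N..int N - 1. Hfun N (Transposition.transpose x (x + 1) ` C) - Hfun N C) =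
     T (int N) - T (- int N) - 2 * (real (card C) - occ C (int N))"
    using sum_int_telescope[of "- int N" "int N" T] sum_occ[OF assms]
    by (simp add: sum_subtractf flip: sum_distrib_left)
  then show ?thesis by (simp add: T_def algebra_simps)
qed

text \<open>Removing an end particle loses \<open>hfun N x\<close>, which is at least N + 1/2 and
  cancels the wall term of \<open>Hfun_bulk\<close>.\<close>

lemma dual_gen_Hfun_le:
  assumes "C \<subseteq> box N" "rm \<le> 1" "rp \<le> 1"
  shows "dual_gen rm rp N (Hfun N) C \<le> - real (card C)"
proof -
  have fin: "finite C" using assms finite_subset finite_box by blast
  have *: "(if x \<in> C then r * Hfun N (C - {x}) - Hfun N C else 0) \<le> - (real N + 1 / 2) * occ C x"
    if "r \<le> 1" "x = int N \<or> x = - int N" for r x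
  proof (cases "x \<in> C")
    case True
    have "0 \<le> Hfun N (C - {x})"
      by (rule order_trans[OF _ Hfun_bounds(1)]) (use assms in auto)
    then have "r * Hfun N (C - {x}) \<le> Hfun N (C - {x})"
      using that(1) mult_right_mono[of r 1] by fastforce
    also have "\<dots> = Hfun N C - hfun N x"
      using True fin by (simp add: Hfun_def sum_diff1)
    finally have "r * Hfun N (C - {x}) - Hfun N C \<le> - hfun N x" by simp
    moreover have "real N + 1 / 2 \<le> hfun N x"
      using that(2) mult_nonneg_nonneg[of "real N" "real N"]
      by (auto simp: hfun_def power2_eq_square algebra_simps simp del: mult_nonneg_nonneg)
    ultimately show ?thesis using True by simp
  qed simp
  show ?thesis
    unfolding dual_gen_def Hfun_bulk[OF assms(1)]
    using *[of rm "- int N"] *[of rp "int N"] assms by (simp add: algebra_simps)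
qed

section \<open>A supersolution built from the mutual distances\<close>

definition Ffun :: "int set \<Rightarrow> int \<Rightarrow> real" where
  "Ffun C x = (\<Sum>y\<in>C. of_bool (y \<le> x))"

text \<open>
  Up to a constant for every particle this is the sum of \<open>2 N + 1 - \<bar>p - q\<bar>\<close> over the pairs of
  particles; the sum of the distances is written as a sum over the bonds separating two particles, so
  that an exchange changes a single summand.
\<close>
definition Jfun :: "nat \<Rightarrow> int set \<Rightarrow> real" where
  "Jfun N C = (2 * real N + 1) / 2 * (real (card C))\<^sup>2
     - (\<Sum>x = - int N..int N - 1. Ffun C x * (real (card C) - Ffun C x))"

lemma Ffun_bounds:
  assumes "finite C"
  shows "0 \<le> Ffun C x" "Ffun C x \<le> real (card C)"
  using sum_bounded_above[of C "\<lambda>y. of_bool (y \<le> x)" "1::real"] assms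
  by (auto simp: Ffun_def intro!: sum_nonneg)

lemma Ffun_Suc:
  assumes "finite C"
  shows "Ffun C (x + 1) = Ffun C x + occ C (x + 1)"
proof -
  have "Ffun C (x + 1) - Ffun C x = (\<Sum>y\<in>C. if y = x + 1 then 1 else 0)"
    unfolding Ffun_def sum_subtractf[symmetric] by (intro sum.cong) auto
  also have "\<dots> = occ C (x + 1)" using assms by simp
  finally show ?thesis by simp
qed

lemma Ffun_right:
  assumes "C \<subseteq> box N"
  shows "Ffun C (int N) = real (card C)"
proof -
  have "Ffun C (int N) = (\<Sum>y\<in>C. 1)"
    unfolding Ffun_def using assms by (intro sum.cong) (auto simp: box_def)
  then show ?thesis by simp
qed

lemma Ffun_left:
  assumes "C \<subseteq> box N"
  shows "Ffun C (- int N) = occ C (- int N)"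
proof -
  have fin: "finite C" using assms finite_subset finite_box by blast
  have "Ffun C (- int N) = (\<Sum>y\<in>C. if y = - int N then 1 else 0)"
    unfolding Ffun_def using assms by (intro sum.cong) (auto simp: box_def)
  then show ?thesis using fin by simp
qed

text \<open>A swap across a bond changes how many particles are on its left only for that very
  bond.\<close>

lemma Ffun_swap:
  assumes "finite C"
  shows "Ffun (Transposition.transpose x (x + 1) ` C) y =
     Ffun C y + (if y = x then occ C (x + 1) - occ C x else 0)"
proof -
  have "of_bool (x + 1 \<le> y) - of_bool (x \<le> y) = (if y = x then - 1 else (0 :: real))" by auto
  then have "Ffun (Transposition.transpose x (x + 1) ` C) y - Ffun C y =
      (occ C x - occ C (x + 1)) * (if y = x then - 1 else 0)"
    unfolding Ffun_def sum_swap[OF assms, where h = "\<lambda>z. of_bool (z \<le> y)"] by simp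
  then show ?thesis by (auto split: if_splits)
qed

text \<open>With F = \<open>Ffun C x\<close> and k particles, the one summand that changes does so
  by (F + d)(k - F - d) - F(k - F) = d(k - 2F) - d^2.\<close>

lemma Jfun_swap:
  assumes "C \<subseteq> box N" "x \<in> {- int N..int N - 1}"
  shows "Jfun N (Transposition.transpose x (x + 1) ` C) - Jfun N C =
    (let d = occ C (x + 1) - occ C x in d\<^sup>2 - d * (real (card C) - 2 * Ffun C x))"
proof -
  have fin: "finite C" using assms finite_subset finite_box by blast
  define k where "k = real (card C)"
  define d where "d = occ C (x + 1) - occ C x"
  have "(\<Sum>y = - int N..int N - 1. Ffun (Transposition.transpose x (x + 1) ` C) y * (k - Ffun (Transposition.transpose x (x + 1) ` C) y))
      - (\<Sum>y = - int N..int N - 1. Ffun C y * (k - Ffun C y))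
    = (\<Sum>y = - int N..int N - 1. if y = x then d * (k - 2 * Ffun C x) - d\<^sup>2 else 0)"
    unfolding sum_subtractf[symmetric] Ffun_swap[OF fin] d_def[symmetric]
    by (intro sum.cong) (auto simp: algebra_simps power2_eq_square)
  also have "\<dots> = d * (k - 2 * Ffun C x) - d\<^sup>2" using assms(2) by simp
  finally show ?thesis
    by (simp add: Jfun_def card_swap Let_def flip: k_def d_def)
qed

text \<open>The distance of two separated particles has no drift. If they are adjacent, the inward
  jumps are suppressed and the two outward ones, of rate 1/2 each, give drift +1, hence -1 for
  \<open>Jfun\<close>. A particle at a wall lacks its outward jump, which costs 1/2 for each of the
  other particles. Formally, d^2 produces the product of neighbouring occupation numbers and all the
  rest telescopes.\<close>

lemma Jfun_bulk:
  assumes "C \<subseteq> box N"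
  shows "1 / 2 * (\<Sum>x = - int N..int N - 1. Jfun N (Transposition.transpose x (x + 1) ` C) - Jfun N C)
    = (real (card C) - 1) / 2 * (occ C (- int N) + occ C (int N)) - adj N C"
proof -
  have fin: "finite C" using assms finite_subset finite_box by blast
  define k where "k = real (card C)"
  define T where "T x = 2 * occ C x * Ffun C x - (k + 1) * occ C x" for x
  have "Jfun N (Transposition.transpose x (x + 1) ` C) - Jfun N C
      = (T (x + 1) - T x) - 2 * (occ C x * occ C (x + 1))" if "x \<in> {- int N..int N - 1}" for x
    unfolding Jfun_swap[OF assms that] T_def Ffun_Suc[OF fin] Let_def k_def[symmetric]
    by (simp add: algebra_simps power2_eq_square)
  then have "(\<Sum>x = - int N..int N - 1. Jfun N (Transposition.transpose x (x + 1) ` C) - Jfun N C) =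
     (\<Sum>x = - int N..int N - 1. (T (x + 1) - T x) - 2 * (occ C x * occ C (x + 1)))"
    by (intro sum.cong) auto
  also have "\<dots> = T (int N) - T (- int N) - 2 * adj N C"
    using sum_int_telescope[of "- int N" "int N" T]
    by (simp add: sum_subtractf adj_def flip: sum_distrib_left)
  also have "\<dots> = (k - 1) * (occ C (- int N) + occ C (int N)) - 2 * adj N C"
    by (simp add: T_def Ffun_right[OF assms] Ffun_left[OF assms] algebra_simps flip: k_def)
  finally show ?thesis by (simp add: k_def)
qed

text \<open>Each of the 2N bonds separates at most k^2/2 pairs, which the leading term of
  \<open>Jfun\<close> covers. The upper bound, linear in N, is what makes the adjacent pairs
  cheap.\<close>

lemma Jfun_bounds:
  assumes "C \<subseteq> box N"
  shows "0 \<le> Jfun N C" "Jfun N C \<le> (2 * real N + 1) / 2 * (real (card C))\<^sup>2"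
proof -
  have fin: "finite C" using assms finite_subset finite_box by blast
  define k where "k = real (card C)"
  have F: "0 \<le> Ffun C x" "Ffun C x \<le> k" for x
    using Ffun_bounds[OF fin] by (auto simp: k_def)
  have le: "Ffun C x * (k - Ffun C x) \<le> k\<^sup>2 / 2" for x
  proof -
    have "0 \<le> (k - Ffun C x)\<^sup>2 + (Ffun C x)\<^sup>2" by simp
    then show ?thesis by (simp add: power2_eq_square algebra_simps)
  qed
  have "(\<Sum>x = - int N..int N - 1. Ffun C x * (k - Ffun C x)) \<le> (2 * real N) * (k\<^sup>2 / 2)"
    using sum_bounded_above[of "{- int N..int N - 1}", OF le] by simp
  also have "\<dots> \<le> (2 * real N + 1) / 2 * k\<^sup>2" by (simp add: algebra_simps)
  finally show "0 \<le> Jfun N C" by (simp add: Jfun_def k_def)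
  have "0 \<le> (\<Sum>x = - int N..int N - 1. Ffun C x * (k - Ffun C x))"
    using F by (intro sum_nonneg mult_nonneg_nonneg) auto
  then show "Jfun N C \<le> (2 * real N + 1) / 2 * (real (card C))\<^sup>2"
    by (simp add: Jfun_def k_def)
qed

text \<open>The leading term falls by (2N + 1)(2k - 1)/2, while each of the 2N bonds gives back at
  most k - 1. The balance is 1/2 - N - k, which is below -k because N is at least 1.\<close>

lemma Jfun_remove:
  assumes "0 < N" and "C \<subseteq> box N" "x \<in> C" "x = int N \<or> x = - int N" "r \<le> 1"
  shows "r * Jfun N (C - {x}) - Jfun N C \<le> - real (card C)"
proof -
  have fin: "finite C" using assms(2) finite_subset finite_box by blast
  define k where "k = real (card C)"
  define I where "I = {- int N..int N - 1}"
  have "card C \<ge> 1" using fin assms(3) by (metis One_nat_def Suc_leI card_gt_0_iff empty_iff)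
  then have k: "real (card (C - {x})) = k - 1" using fin assms(3) by (simp add: k_def of_nat_diff)
  have rem: "Ffun (C - {x}) y = Ffun C y - of_bool (x \<le> y)" for y
    using sum.remove[OF fin assms(3), of "\<lambda>z. of_bool (z \<le> y) :: real"] unfolding Ffun_def by linarith
  have F: "0 \<le> Ffun (C - {x}) y" "Ffun (C - {x}) y \<le> k - 1" for y
    using Ffun_bounds[of "C - {x}" y] fin k by auto
  have le: "Ffun C y * (k - Ffun C y) - Ffun (C - {x}) y * (k - 1 - Ffun (C - {x}) y) \<le> k - 1"
    if y: "y \<in> I" for y
  proof (cases "x \<le> y")
    case True
    then have "Ffun C y = Ffun (C - {x}) y + 1" using rem[of y] by simp
    then show ?thesis using F[of y] by (simp add: algebra_simps)
  next
    case False
    then have "Ffun C y = Ffun (C - {x}) y" using rem[of y] by simp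
    then show ?thesis using F[of y] by (simp add: algebra_simps)
  qed
  have "(\<Sum>y\<in>I. Ffun C y * (k - Ffun C y)) - (\<Sum>y\<in>I. Ffun (C - {x}) y * (k - 1 - Ffun (C - {x}) y))
      \<le> 2 * real N * (k - 1)"
    unfolding sum_subtractf[symmetric]
    using sum_bounded_above[of I, OF le] by (simp add: I_def)
  moreover have "(2 * real N + 1) / 2 * (k - 1)\<^sup>2 - (2 * real N + 1) / 2 * k\<^sup>2 + 2 * real N * (k - 1)
      = 1 / 2 - real N - k"
    by (simp add: power2_eq_square field_simps)
  moreover have "1 \<le> real N" using \<open>0 < N\<close> by simp
  ultimately have "Jfun N (C - {x}) - Jfun N C \<le> - k"
    unfolding Jfun_def k k_def[symmetric] I_def[symmetric] by linarith
  moreover have "r * Jfun N (C - {x}) \<le> Jfun N (C - {x})"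
    using assms(5) Jfun_bounds(1)[of "C - {x}" N] assms(2) mult_right_mono[of r 1 "Jfun N (C - {x})"] by auto
  ultimately show ?thesis by (simp add: k_def)
qed

text \<open>The wall term (k - 1)/2 of \<open>Jfun_bulk\<close> is dominated by the loss k from
  removing the particle at that wall.\<close>

lemma dual_gen_Jfun_le:
  assumes "0 < N" and "C \<subseteq> box N" "rm \<le> 1" "rp \<le> 1"
  shows "dual_gen rm rp N (Jfun N) C \<le> - adj N C"
proof -
  have *: "(if x \<in> C then r * Jfun N (C - {x}) - Jfun N C else 0) \<le> - ((real (card C) - 1) / 2) * occ C x"
    if "r \<le> 1" "x = int N \<or> x = - int N" for r x
  proof (cases "x \<in> C")
    case True
    have "- real (card C) \<le> - ((real (card C) - 1) / 2)" by simp
    with Jfun_remove[OF assms(1,2) True that(2,1)]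
    have "r * Jfun N (C - {x}) - Jfun N C \<le> - ((real (card C) - 1) / 2)" by (rule order_trans)
    then show ?thesis using True by simp
  qed simp
  show ?thesis
    unfolding dual_gen_def Jfun_bulk[OF assms(2)]
    using *[of rm "- int N"] *[of rp "int N"] assms by (simp add: algebra_simps)
qed

text \<open>
  The stationary density for frozen reservoirs: linear, with the values \<open>rm\<close> and \<open>rp\<close> at
  \<open>\<mp> (N + 1/2)\<close>.
\<close>
definition profile :: "real \<Rightarrow> real \<Rightarrow> nat \<Rightarrow> int \<Rightarrow> real" where
  "profile rm rp N y = (rp + rm) / 2 + (rp - rm) * real_of_int y / (2 * real N + 1)"

lemma profile_convex:
  "profile rm rp N y = rp * (1 / 2 + real_of_int y / (2 * real N + 1)) + rm * (1 / 2 - real_of_int y / (2 * real N + 1))"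
  by (simp add: profile_def add_divide_distrib diff_divide_distrib algebra_simps)

text \<open>On the box the profile is a convex combination of its two parameters. The general bound
  \<open>D\<close> serves both the densities, with value 1, and their time derivatives.\<close>

lemma profile_abs_le:
  assumes "y \<in> box N" "\<bar>rm\<bar> \<le> D" "\<bar>rp\<bar> \<le> D"
  shows "\<bar>profile rm rp N y\<bar> \<le> D"
proof -
  define a where "a = real_of_int y / (2 * real N + 1)"
  have a: "\<bar>a\<bar> \<le> 1 / 2" using assms(1) by (auto simp: a_def box_def abs_le_iff field_simps)
  have "\<bar>profile rm rp N y\<bar> \<le> \<bar>rp\<bar> * (1 / 2 + a) + \<bar>rm\<bar> * (1 / 2 - a)"
    unfolding profile_convex a_def[symmetric]
    using a by (intro order_trans[OF abs_triangle_ineq]) (auto simp: abs_mult)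
  also have "\<dots> \<le> D * (1 / 2 + a) + D * (1 / 2 - a)"
    using a assms by (intro add_mono mult_right_mono) auto
  finally show ?thesis by (simp add: algebra_simps)
qed

lemma profile_nonneg:
  assumes "y \<in> box N" "0 \<le> rm" "0 \<le> rp"
  shows "0 \<le> profile rm rp N y"
proof -
  define a where "a = real_of_int y / (2 * real N + 1)"
  have a: "\<bar>a\<bar> \<le> 1 / 2" using assms(1) by (auto simp: a_def box_def abs_le_iff field_simps)
  then show ?thesis unfolding profile_convex a_def[symmetric] using assms by auto
qed

text \<open>For a single particle on the bond the swap is of first order in the slope
  \<open>b\<close>, in a form that telescopes. If both sites are occupied the swap does nothing, but
  the telescoping form gives b^2 times the remaining product; the last term corrects for
  this.\<close>

lemma prod_swap:
  fixes r :: "int \<Rightarrow> real"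
  assumes "finite C" and b: "r (x + 1) = r x + b"
  shows "(\<Prod>y\<in>Transposition.transpose x (x + 1) ` C. r y) - (\<Prod>y\<in>C. r y) =
           b * (occ C x * (\<Prod>y\<in>C - {x}. r y) - occ C (x + 1) * (\<Prod>y\<in>C - {x + 1}. r y))
           - b\<^sup>2 * (occ C x * occ C (x + 1) * (\<Prod>y\<in>C - {x, x + 1}. r y))"
proof -
  have b': "r (1 + x) = r x + b" using b by (simp add: add.commute)
  consider "x \<in> C" "x + 1 \<in> C" | "x \<in> C" "x + 1 \<notin> C" | "x \<notin> C" "x + 1 \<in> C" | "x \<notin> C" "x + 1 \<notin> C"
    by blast
  then show ?thesis
  proof cases
    case 1
    then have "(\<Prod>y\<in>C - {x}. r y) = r (x + 1) * (\<Prod>y\<in>C - {x} - {x + 1}. r y)"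
      and "(\<Prod>y\<in>C - {x + 1}. r y) = r x * (\<Prod>y\<in>C - {x + 1} - {x}. r y)"
      using assms(1) by (auto intro!: prod.remove)
    moreover have "C - {x} - {x + 1} = C - {x, x + 1}" "C - {x + 1} - {x} = C - {x, x + 1}" by auto
    ultimately show ?thesis
      unfolding transpose_Suc_image using 1 by (simp add: b' algebra_simps power2_eq_square)
  next
    case 2
    then show ?thesis
      using assms(1) prod.remove[of C x r] unfolding transpose_Suc_image by (simp add: b' algebra_simps)
  next
    case 3
    then show ?thesis
      using assms(1) prod.remove[of C "x + 1" r] unfolding transpose_Suc_image by (simp add: b' algebra_simps)
  qed (simp add: transpose_Suc_image)
qed

text \<open>The first-order terms telescope to the two ends and are cancelled there by the removals,
  so only the correction for adjacent pairs survives.\<close>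

lemma dual_gen_profile:
  fixes rm rp :: real
  assumes "C \<subseteq> box N"
  defines "r \<equiv> profile rm rp N"
  shows "dual_gen rm rp N (\<lambda>C. \<Prod>y\<in>C. r y) C =
    - (((rp - rm) / (2 * real N + 1))\<^sup>2 / 2) *
      (\<Sum>x = - int N..int N - 1. occ C x * occ C (x + 1) * (\<Prod>y\<in>C - {x, x + 1}. r y))"
proof -
  have fin: "finite C" using assms finite_subset finite_box by blast
  define b where "b = (rp - rm) / (2 * real N + 1)"
  have step: "r (x + 1) = r x + b" for x
    by (simp add: r_def profile_def b_def add_divide_distrib diff_divide_distrib algebra_simps)
  define T where "T x = - b * (occ C x * (\<Prod>y\<in>C - {x}. r y))" for x
  define A where "A = (\<Sum>x = - int N..int N - 1. occ C x * occ C (x + 1) * (\<Prod>y\<in>C - {x, x + 1}. r y))"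
  have "(\<Sum>x = - int N..int N - 1. (\<Prod>y\<in>Transposition.transpose x (x + 1) ` C. r y) - (\<Prod>y\<in>C. r y))
    = (\<Sum>x = - int N..int N - 1. (T (x + 1) - T x) - b\<^sup>2 * (occ C x * occ C (x + 1) * (\<Prod>y\<in>C - {x, x + 1}. r y)))"
    unfolding prod_swap[of C r, OF fin step] T_def by (simp add: algebra_simps)
  also have "\<dots> = T (int N) - T (- int N) - b\<^sup>2 * A"
    unfolding A_def sum_distrib_left sum_subtractf[of "\<lambda>x. T (x + 1) - T x"]
    using sum_int_telescope[of "- int N" "int N" T] by simp
  finally have bulk: "1 / 2 * (\<Sum>x = - int N..int N - 1. (\<Prod>y\<in>Transposition.transpose x (x + 1) ` C. r y) - (\<Prod>y\<in>C. r y))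
    = (T (int N) - T (- int N)) / 2 - b\<^sup>2 / 2 * A" by simp
  \<comment> \<open>This is where the reservoir values at distance N + 1/2 matter: the end sites are
    half a step away from them, and half a step is exactly what the factor 1/2 of the exchange part
    requires.\<close>
  have "rp - r (int N) = b / 2" "rm - r (- int N) = - b / 2"
    by (simp_all add: r_def profile_def b_def field_simps)
  moreover have "q * (\<Prod>y\<in>C - {x}. r y) - (\<Prod>y\<in>C. r y) = (q - r x) * (\<Prod>y\<in>C - {x}. r y)"
    if "x \<in> C" for x q
    unfolding prod.remove[OF fin that, of r] by (rule left_diff_distrib[symmetric])
  ultimately have ends: "(if int N \<in> C then rp * (\<Prod>y\<in>C - {int N}. r y) - (\<Prod>y\<in>C. r y) else 0) = - T (int N) / 2"
    and ends': "(if - int N \<in> C then rm * (\<Prod>y\<in>C - {- int N}. r y) - (\<Prod>y\<in>C. r y) else 0) = T (- int N) / 2"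
    by (simp_all add: T_def)
  show ?thesis
    unfolding dual_gen_def bulk ends ends' b_def[symmetric] A_def[symmetric] by (simp add: diff_divide_distrib)
qed

section \<open>Asymptotic factorisation of the correlations\<close>

lemma has_real_derivative_prod:
  fixes f :: "'i \<Rightarrow> real \<Rightarrow> real"
  assumes "\<And>i. i \<in> I \<Longrightarrow> (f i has_real_derivative f' i) (at x within S)"
  shows "((\<lambda>x. \<Prod>i\<in>I. f i x) has_real_derivative (\<Sum>i\<in>I. f' i * (\<Prod>j\<in>I - {i}. f j x))) (at x within S)"
  unfolding has_field_derivative_def
  by (rule has_derivative_eq_rhs[OF has_derivative_prod[OF assms[unfolded has_field_derivative_def]]])
    (auto simp: fun_eq_iff sum_distrib_left mult_ac)

lemma dual_gen_profile_bound:
  assumes "C \<subseteq> box N" "0 < N" "0 \<le> rm" "rm \<le> 1" "0 \<le> rp" "rp \<le> 1"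
  shows "\<bar>dual_gen rm rp N (\<lambda>C. \<Prod>y\<in>C. profile rm rp N y) C\<bar> \<le> adj N C / (real N)\<^sup>2"
proof -
  define A where "A = (\<Sum>x = - int N..int N - 1. occ C x * occ C (x + 1) * (\<Prod>y\<in>C - {x, x + 1}. profile rm rp N y))"
  have "\<bar>\<Prod>y\<in>C'. profile rm rp N y\<bar> \<le> 1" if "C' \<subseteq> C" for C'
    unfolding abs_prod
    by (rule prod_le_1) (use that assms profile_abs_le[of _ N rm 1 rp] in auto)
  then have "\<bar>A\<bar> \<le> adj N C"
    unfolding A_def adj_def by (intro order_trans[OF sum_abs] sum_mono) auto
  moreover have "\<bar>(rp - rm) / (2 * real N + 1)\<bar> \<le> 1 / real N"
  proof -
    have "\<bar>rp - rm\<bar> \<le> 1" using assms by auto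
    then have "\<bar>(rp - rm) / (2 * real N + 1)\<bar> \<le> 1 / (2 * real N + 1)" 
      by (simp add: divide_right_mono)
    also have "\<dots> \<le> 1 / real N" using assms(2) by (simp add: frac_le)
    finally show ?thesis .
  qed
  then have "((rp - rm) / (2 * real N + 1))\<^sup>2 / 2 \<le> (1 / real N)\<^sup>2"
    using power_mono[of "\<bar>(rp - rm) / (2 * real N + 1)\<bar>" "1 / real N" 2] 
    by (simp only: power2_abs) (smt (verit) zero_le_power2 field_sum_of_halves)
  ultimately have "((rp - rm) / (2 * real N + 1))\<^sup>2 / 2 * \<bar>A\<bar> \<le> (1 / real N)\<^sup>2 * adj N C"
    by (intro mult_mono) auto
  then show ?thesis
    unfolding dual_gen_profile[OF assms(1)] A_def[symmetric] abs_mult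
    by (simp add: power_divide)
qed

text \<open>
  The three terms account for the initial condition, the adjacent pairs and the time dependence of the
  reservoirs.
\<close>
definition corr_err :: "real \<Rightarrow> real \<Rightarrow> nat \<Rightarrow> nat \<Rightarrow> real \<Rightarrow> real" where
  "corr_err \<alpha> D K N s =
     4 * real K * exp (- (real N powr (2 + \<alpha>) / (2 * real K * (real N + 1)\<^sup>2)) * s)
     + (2 * real N + 1) / 2 * (real K)\<^sup>2 / (real N)\<^sup>2
     + (real K * D + 1) / real N powr (2 + \<alpha>) * (2 * real K * (real N + 1)\<^sup>2)"

text \<open>The comparison principle is applied to \<open>\<Psi> - \<sigma> * (u - v)\<close> for
  both signs \<open>\<sigma>\<close>. The three terms of \<open>corr_err\<close> bound the three
  terms of \<open>\<Psi>\<close>, after \<open>Hfun\<close> and \<open>Jfun\<close> are replaced by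
  their maxima over at most K particles.\<close>

proposition correlation_estimate:
  fixes q :: "real \<Rightarrow> config pmf" and \<rho>m \<rho>p \<rho>m' \<rho>p' :: "real \<Rightarrow> real"
  assumes N: "0 < N" and K: "0 < K"
    and rm: "\<And>s. 0 \<le> s \<Longrightarrow> 0 \<le> \<rho>m s \<and> \<rho>m s \<le> 1"
    and rp: "\<And>s. 0 \<le> s \<Longrightarrow> 0 \<le> \<rho>p s \<and> \<rho>p s \<le> 1"
    and rm': "\<And>s. 0 \<le> s \<Longrightarrow> (\<rho>m has_real_derivative \<rho>m' s) (at s within {0..})"
    and rp': "\<And>s. 0 \<le> s \<Longrightarrow> (\<rho>p has_real_derivative \<rho>p' s) (at s within {0..})"
    and D: "\<And>s. 0 \<le> s \<Longrightarrow> \<bar>\<rho>m' s\<bar> \<le> D" "\<And>s. 0 \<le> s \<Longrightarrow> \<bar>\<rho>p' s\<bar> \<le> D"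
    and fin: "\<And>s. 0 \<le> s \<Longrightarrow> finite (set_pmf (q s))"
    and fwd: "\<And>s C. 0 \<le> s \<Longrightarrow>
      ((\<lambda>r. measure_pmf.expectation (q r) (mon C)) has_real_derivative
         measure_pmf.expectation (q s) (gen \<alpha> \<rho>m \<rho>p N s (mon C))) (at s within {0..})"
    and C: "C \<subseteq> box N" "card C \<le> K" and s: "0 \<le> s"
  shows "\<bar>measure_pmf.expectation (q s) (mon C) - (\<Prod>y\<in>C. profile (\<rho>m s) (\<rho>p s) N y)\<bar> \<le> corr_err \<alpha> D K N s"
proof -
  define \<kappa> where "\<kappa> = real N powr (2 + \<alpha>)"
  have kap: "0 < \<kappa>" using N by (simp add: \<kappa>_def)
  have D0: "0 \<le> D" using D(1)[of 0] by auto
  define n1 where "n1 = (real N + 1)\<^sup>2"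
  have n1: "0 < n1" by (simp add: n1_def)
  define lam where "lam = \<kappa> / (2 * real K * n1)"
  define u where "u C s = measure_pmf.expectation (q s) (mon C)" for C s
  define v where "v C s = (\<Prod>y\<in>C. profile (\<rho>m s) (\<rho>p s) N y)" for C s
  define v' where "v' C s = (\<Sum>x\<in>C. profile (\<rho>m' s) (\<rho>p' s) N x * (\<Prod>y\<in>C - {x}. profile (\<rho>m s) (\<rho>p s) N y))" for C s
  define gD where "gD s = dual_gen (\<rho>m s) (\<rho>p s) N" for s
  \<comment> \<open>The first term is at least 2 at time 0, more than any possible initial
    discrepancy. The factor 1/N^2 of \<open>Jfun\<close> matches the defect of the profile. In the
    last term \<open>real K * D\<close> pays for the time derivative of \<open>v\<close>, and 1 is
    the surplus for strictness.\<close>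
  define \<Psi> where "\<Psi> C s = 2 * exp (- lam * s) / n1 * Hfun N C + (1 / (real N)\<^sup>2 * Jfun N C + (real K * D + 1) / \<kappa> * Hfun N C)" for C s
  define \<Psi>' where "\<Psi>' C s = - lam * (2 * exp (- lam * s) / n1 * Hfun N C)" for C s
  \<comment> \<open>The empty set is left out because \<open>\<Psi>\<close> vanishes there and
    cannot be strictly positive; \<open>u\<close> and \<open>v\<close> are both 1 on it.\<close>
  define I where "I = {C. C \<subseteq> box N \<and> C \<noteq> {} \<and> card C \<le> K}"
  have finI: "finite I" unfolding I_def by (rule finite_subset[of _ "Pow (box N)"]) auto
  have u': "((\<lambda>r. u C r) has_real_derivative \<kappa> * gD s (\<lambda>C. u C s) C) (at s within {0..})" if "0 \<le> s" for C s
    using fwd[OF that, of C] expectation_dual_gen[OF fin[OF that]]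
    unfolding u_def gen_mon gD_def \<kappa>_def by simp
  have v'd: "((\<lambda>r. v C r) has_real_derivative v' C s) (at s within {0..})" if "0 \<le> s" for C s
    unfolding v_def v'_def profile_def[abs_def]
    by (rule has_real_derivative_prod) (intro DERIV_add DERIV_diff DERIV_cdivide DERIV_cmult_right rm'[OF that] rp'[OF that])
  have \<Psi>d: "((\<lambda>r. \<Psi> C r) has_real_derivative \<Psi>' C s) (at s within {0..})" for C s
    unfolding \<Psi>_def \<Psi>'_def using n1 by (auto intro!: derivative_eq_intros)
  have v'_bound: "\<bar>v' C s\<bar> \<le> real K * D" if "C \<in> I" "0 \<le> s" for C s
  proof -
    have pr: "\<bar>\<Prod>y\<in>C - {x}. profile (\<rho>m s) (\<rho>p s) N y\<bar> \<le> 1" for x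
      unfolding abs_prod
      by (rule prod_le_1) (use that rm rp profile_abs_le[of _ N "\<rho>m s" 1 "\<rho>p s"] in \<open>auto simp: I_def\<close>)
    have "\<bar>v' C s\<bar> \<le> (\<Sum>x\<in>C. D * 1)"
      unfolding v'_def
      by (intro order_trans[OF sum_abs] sum_mono, unfold abs_mult, intro mult_mono pr profile_abs_le)
        (use that D D0 in \<open>auto simp: I_def\<close>)
    also have "\<dots> \<le> real K * D" using that D0 by (auto simp: I_def intro: mult_right_mono)
    finally show ?thesis .
  qed
  have supersol: "\<kappa> * gD s (\<lambda>C. \<Psi> C s) C + \<kappa> / (real N)\<^sup>2 * adj N C + real K * D + 1 \<le> \<Psi>' C s"
    if "C \<in> I" "0 \<le> s" for C s
  proof -
    have CI: "C \<subseteq> box N" "1 \<le> card C" "card C \<le> K"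
      using that finite_subset[of C "box N"] by (auto simp: I_def Suc_le_eq card_gt_0_iff)
    define e where "e = 2 * exp (- lam * s) / n1"
    have e: "0 \<le> e" using n1 by (simp add: e_def)
    have h: "gD s (Hfun N) C \<le> - 1"
      using dual_gen_Hfun_le[OF CI(1), of "\<rho>m s" "\<rho>p s"] rm rp that(2) CI(2) by (force simp: gD_def)
    have j: "gD s (Jfun N) C \<le> - adj N C"
      using dual_gen_Jfun_le[OF N CI(1), of "\<rho>m s" "\<rho>p s"] rm rp that(2) by (force simp: gD_def)
    have "Hfun N C \<le> 2 * real (card C) * n1" using Hfun_bounds(2)[OF CI(1)] by (simp add: n1_def)
    also have "\<dots> \<le> 2 * real K * n1" using CI n1 by simp
    finally have H: "Hfun N C \<le> 2 * real K * n1" .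
    have lamK: "lam * (2 * real K * n1) = \<kappa>" using K n1 by (simp add: lam_def)
    \<comment> \<open>The rate \<open>lam\<close> is \<open>\<kappa>\<close> divided by the largest
      value of \<open>Hfun\<close>, the fastest decay that the drift -1 of \<open>Hfun\<close> can
      pay for.\<close>
    have "lam * (e * Hfun N C) \<le> lam * (e * (2 * real K * n1))"
      using e H kap n1 by (intro mult_left_mono) (auto simp: lam_def)
    also have "\<dots> = \<kappa> * e" using lamK by (simp add: algebra_simps)
    finally have 1: "- (\<kappa> * e) \<le> \<Psi>' C s" by (simp add: \<Psi>'_def e_def)
    have "gD s (\<lambda>C. \<Psi> C s) C = e * gD s (Hfun N) C + (1 / (real N)\<^sup>2 * gD s (Jfun N) C + (real K * D + 1) / \<kappa> * gD s (Hfun N) C)"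
      unfolding \<Psi>_def gD_def e_def[symmetric] dual_gen_add dual_gen_cmult ..
    also have "\<dots> \<le> e * (- 1) + (1 / (real N)\<^sup>2 * (- adj N C) + (real K * D + 1) / \<kappa> * (- 1))"
      using h j e kap D0 by (intro add_mono mult_left_mono) auto
    finally have "\<kappa> * gD s (\<lambda>C. \<Psi> C s) C \<le> \<kappa> * (e * (- 1) + (1 / (real N)\<^sup>2 * (- adj N C) + (real K * D + 1) / \<kappa> * (- 1)))"
      using kap by simp
    also have "\<dots> = - (\<kappa> * e) - \<kappa> / (real N)\<^sup>2 * adj N C - (real K * D + 1)"
      using kap by (simp add: field_simps)
    finally show ?thesis using 1 by linarith
  qed
  have \<Psi>_nonneg: "0 \<le> \<Psi> C s" if "C \<subseteq> box N" for C s
  proof -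
    have "0 \<le> real (card C) * n1" using n1 by simp
    also have "\<dots> \<le> Hfun N C" using Hfun_bounds(1)[OF that] by (simp add: n1_def)
    finally show ?thesis using Jfun_bounds(1)[OF that] n1 kap D0 by (simp add: \<Psi>_def)
  qed
  have main: "0 < \<Psi> C s - \<sigma> * (u C s - v C s)" if "C \<in> I" "\<bar>\<sigma>\<bar> = 1" for \<sigma>
  proof (rule finite_system_positive[where I = I and z = "\<lambda>C s. \<Psi> C s - \<sigma> * (u C s - v C s)"
        and z' = "\<lambda>C s. \<Psi>' C s - \<sigma> * (\<kappa> * gD s (\<lambda>C. u C s) C - v' C s)", OF finI _ _ _ that(1) s])
    fix C s assume C: "C \<in> I" and s: "(0::real) \<le> s"
    show "((\<lambda>s. \<Psi> C s - \<sigma> * (u C s - v C s)) has_real_derivative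
        \<Psi>' C s - \<sigma> * (\<kappa> * gD s (\<lambda>C. u C s) C - v' C s)) (at s within {0..})"
      by (intro DERIV_diff DERIV_cmult \<Psi>d u'[OF s] v'd[OF s])
  next
    fix C assume C: "C \<in> I"
    then have CI: "C \<subseteq> box N" "1 \<le> card C"
      using finite_subset[of C "box N"] by (auto simp: I_def Suc_le_eq card_gt_0_iff)
    have "n1 \<le> real (card C) * n1" using CI n1 by simp
    also have "\<dots> \<le> Hfun N C" using Hfun_bounds(1)[OF CI(1)] by (simp add: n1_def)
    finally have "n1 \<le> Hfun N C" .
    \<comment> \<open>At time 0 both \<open>u\<close> and \<open>v\<close> lie in the unit interval,
      so 2 exceeds their difference strictly.\<close>
    then have "2 \<le> 2 / n1 * Hfun N C" "0 \<le> Hfun N C" using n1 by (auto simp: field_simps)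
    then have "2 \<le> \<Psi> C 0"
      using Jfun_bounds(1)[OF CI(1)] kap D0 by (simp add: \<Psi>_def add_increasing2)
    moreover have "0 \<le> u C 0" "u C 0 \<le> 1"
      unfolding u_def using mon_bounds[of C]
      by (auto intro!: integral_nonneg_AE measure_pmf.integral_le_const measure_pmf.integrable_const_bound[where B = 1])
    moreover have "0 \<le> v C 0" "v C 0 \<le> 1"
      unfolding v_def using CI rm[of 0] rp[of 0] profile_nonneg[of _ N "\<rho>m 0" "\<rho>p 0"] profile_abs_le[of _ N "\<rho>m 0" 1 "\<rho>p 0"]
      by (auto intro!: prod_nonneg prod_le_1)
    ultimately show "0 < \<Psi> C 0 - \<sigma> * (u C 0 - v C 0)"
      using that(2) by (cases "\<sigma> \<ge> 0") auto
  next
    fix C s assume C: "C \<in> I" and s: "(0::real) \<le> s"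
      and zero: "\<Psi> C s - \<sigma> * (u C s - v C s) = 0"
      and nonneg: "\<And>C'. C' \<in> I \<Longrightarrow> 0 \<le> \<Psi> C' s - \<sigma> * (u C' s - v C' s)"
    have CI: "C \<subseteq> box N" using C by (auto simp: I_def)
    \<comment> \<open>At a touching point cooperativity gives the sign of the dual generator on the
      whole combination. Linearity then splits off \<open>u\<close>, whose evolution is exact, and
      \<open>v\<close>, whose defect is bounded by the adjacent pairs.\<close>
    have "0 \<le> gD s (\<lambda>C. \<Psi> C s - \<sigma> * (u C s - v C s)) C"
      unfolding gD_def
    proof (rule dual_gen_at_zero_nonneg)
      fix C' assume C': "C' \<subseteq> box N" "card C' \<le> card C"
      show "0 \<le> \<Psi> C' s - \<sigma> * (u C' s - v C' s)"
      \<comment> \<open>Removing the last particle leads to the empty set outside \<open>I\<close>,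
        where the combination reduces to \<open>\<Psi>\<close>.\<close>
      proof (cases "C' = {}")
        case True
        have "u {} s = 1" by (simp add: u_def)
        then show ?thesis using \<Psi>_nonneg[of "{}" s] by (simp add: True v_def)
      next
        case False
        then show ?thesis using C C' by (intro nonneg) (auto simp: I_def)
      qed
    qed (use rm[OF s] rp[OF s] zero CI in auto)
    also have "\<dots> = gD s (\<lambda>C. \<Psi> C s) C - \<sigma> * (gD s (\<lambda>C. u C s) C - gD s (\<lambda>C. v C s) C)"
      by (simp add: gD_def dual_gen_diff dual_gen_cmult)
    finally have "0 \<le> \<kappa> * (gD s (\<lambda>C. \<Psi> C s) C - \<sigma> * (gD s (\<lambda>C. u C s) C - gD s (\<lambda>C. v C s) C))"
      using kap by simp
    then have a: "\<sigma> * (\<kappa> * gD s (\<lambda>C. u C s) C) \<le> \<kappa> * gD s (\<lambda>C. \<Psi> C s) C + \<sigma> * (\<kappa> * gD s (\<lambda>C. v C s) C)"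
      by (simp add: algebra_simps)
    have "\<bar>gD s (\<lambda>C. v C s) C\<bar> \<le> adj N C / (real N)\<^sup>2"
      using dual_gen_profile_bound[OF CI N] rm[OF s] rp[OF s] by (simp add: gD_def v_def)
    then have "\<bar>\<kappa> * gD s (\<lambda>C. v C s) C\<bar> \<le> \<kappa> * (adj N C / (real N)\<^sup>2)"
      using kap by (simp add: abs_mult mult_left_mono del: times_divide_eq_right)
    then have "\<sigma> * (\<kappa> * gD s (\<lambda>C. v C s) C) \<le> \<kappa> / (real N)\<^sup>2 * adj N C"
      using that(2) by (cases "\<sigma> \<ge> 0") (auto simp: abs_le_iff)
    moreover have "- (real K * D) \<le> \<sigma> * v' C s"
      using v'_bound[OF C s] that(2) by (cases "\<sigma> \<ge> 0") (auto simp: abs_le_iff)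
    ultimately show "0 < \<Psi>' C s - \<sigma> * (\<kappa> * gD s (\<lambda>C. u C s) C - v' C s)"
      using a supersol[OF C s] by (simp add: right_diff_distrib)
  qed
  show ?thesis
  proof (cases "C = {}")
    case True
    then show ?thesis using D0 by (simp add: corr_err_def)
  next
    case False
    then have CI: "C \<in> I" using C by (simp add: I_def)
    have HK: "Hfun N C \<le> 2 * real K * n1"
      by (rule order_trans[OF Hfun_bounds(2)[OF C(1)]]) (use C n1 in \<open>simp add: n1_def\<close>)
    have "(real (card C))\<^sup>2 \<le> (real K)\<^sup>2" using C(2) by simp
    then have JK: "Jfun N C \<le> (2 * real N + 1) / 2 * (real K)\<^sup>2"
      by (intro order_trans[OF Jfun_bounds(2)[OF C(1)]] mult_left_mono) auto
    have "\<bar>u C s - v C s\<bar> \<le> \<Psi> C s"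
      using main[OF CI, of 1] main[OF CI, of "-1"] by auto
    also have "\<dots> \<le> 2 * exp (- lam * s) / n1 * (2 * real K * n1) + (1 / (real N)\<^sup>2 * ((2 * real N + 1) / 2 * (real K)\<^sup>2) + (real K * D + 1) / \<kappa> * (2 * real K * n1))"
      unfolding \<Psi>_def using HK JK n1 kap D0 by (intro add_mono mult_left_mono) auto
    also have "\<dots> = corr_err \<alpha> D K N s"
      using n1 by (simp add: corr_err_def lam_def flip: n1_def \<kappa>_def)
    finally show ?thesis by (simp add: u_def v_def)
  qed
qed

text \<open>The exponent is of order N^\<alpha> times \<open>s\<close>, the second term is of order
  1/N and the third of order N^(-\<alpha>).\<close>

lemma corr_err_tendsto:
  assumes "0 < \<alpha>" "0 < K" "0 < s"
  shows "(\<lambda>N. corr_err \<alpha> D K N s) \<longlonglongrightarrow> 0"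
proof -
  have K: "0 < real K" using assms by simp
  have grow: "filterlim (\<lambda>N. real N powr (2 + \<alpha>) / (real N + 1)\<^sup>2) at_top sequentially"
    using assms(1) by real_asymp
  have "filterlim (\<lambda>N. real N powr (2 + \<alpha>) / (real N + 1)\<^sup>2 * (s / (2 * real K))) at_top sequentially"
    by (rule filterlim_at_top_mult_tendsto_pos[OF tendsto_const _ grow]) (use assms K in auto)
  then have "(\<lambda>N. exp (- (real N powr (2 + \<alpha>) / (real N + 1)\<^sup>2 * (s / (2 * real K))))) \<longlonglongrightarrow> 0"
    by (intro filterlim_compose[OF exp_at_bot] filterlim_compose[OF filterlim_uminus_at_bot_at_top])
  from tendsto_mult_right[OF this, of "4 * real K"]
  have 1: "(\<lambda>N. 4 * real K * exp (- (real N powr (2 + \<alpha>) / (2 * real K * (real N + 1)\<^sup>2)) * s)) \<longlonglongrightarrow> 0"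
    by (simp add: mult_ac)
  have "(\<lambda>N. (2 * real N + 1) / 2 / (real N)\<^sup>2) \<longlonglongrightarrow> 0" by real_asymp
  from tendsto_mult_right[OF this, of "(real K)\<^sup>2"]
  have 2: "(\<lambda>N. (2 * real N + 1) / 2 * (real K)\<^sup>2 / (real N)\<^sup>2) \<longlonglongrightarrow> 0"
    by (simp add: mult_ac)
  have "(\<lambda>N. inverse (real N powr (2 + \<alpha>) / (real N + 1)\<^sup>2)) \<longlonglongrightarrow> 0"
    using grow by (rule tendsto_inverse_0_at_top)
  from tendsto_mult_right[OF this, of "E * (2 * real K)" for E]
  have 3: "(\<lambda>N. E / real N powr (2 + \<alpha>) * (2 * real K * (real N + 1)\<^sup>2)) \<longlonglongrightarrow> 0" for E
    by (simp add: divide_inverse mult_ac)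
  show ?thesis
    using tendsto_add[OF tendsto_add[OF 1 2] 3] unfolding corr_err_def by simp
qed

section \<open>Local functions and spatial averages\<close>

text \<open>Every local function is a linear combination of products of occupation numbers. Sites
  are peeled off one at a time, and the factor \<open>mon B\<close> records those already treated,
  so that the induction closes.\<close>

lemma local_function_induct [consumes 1, case_names mon comb]:
  assumes "local_function \<phi>"
    and mon: "\<And>B. finite B \<Longrightarrow> Q (mon B)"
    and comb: "\<And>f g a. Q f \<Longrightarrow> Q g \<Longrightarrow> Q (\<lambda>\<eta>. f \<eta> + a * g \<eta>)"
  shows "Q \<phi>"
proof -
  have *: "Q (\<lambda>\<eta>. mon B \<eta> * \<psi> \<eta>)" if "finite A" "finite B" "depends_only_on \<psi> A" for A B \<psi>
    using that
  proof (induction A arbitrary: B \<psi> rule: finite_induct)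
    case empty
    define k where "k = \<psi> (\<lambda>_. True)"
    have "\<psi> \<eta> = k" for \<eta> using empty by (simp add: depends_only_on_def k_def)
    \<comment> \<open>The rule \<open>comb\<close> has coefficient 1 on its first function, so the
      multiple k is written as 1 + (k - 1).\<close>
    then have "(\<lambda>\<eta>. mon B \<eta> * \<psi> \<eta>) = (\<lambda>\<eta>. mon B \<eta> + (k - 1) * mon B \<eta>)"
      by (simp add: fun_eq_iff algebra_simps)
    with comb[OF mon mon] empty show ?case by metis
  next
    case (insert x A)
    define \<psi>1 where "\<psi>1 \<eta> = \<psi> (\<eta>(x := True))" for \<eta>
    define \<psi>0 where "\<psi>0 \<eta> = \<psi> (\<eta>(x := False))" for \<eta>
    have "depends_only_on \<psi>1 A" "depends_only_on \<psi>0 A"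
      using insert.prems(2) by (auto simp: depends_only_on_def \<psi>0_def \<psi>1_def)
    then have Q: "Q (\<lambda>\<eta>. mon B \<eta> * \<psi>0 \<eta>)" "Q (\<lambda>\<eta>. mon (insert x B) \<eta> * \<psi>1 \<eta>)"
        "Q (\<lambda>\<eta>. mon (insert x B) \<eta> * \<psi>0 \<eta>)"
      using insert.IH insert.prems(1) by auto
    \<comment> \<open>This is the expansion of \<open>\<psi>\<close> as \<psi>0 plus the occupation
      number at x times (\<psi>1 - \<psi>0).\<close>
    have "mon B \<eta> * \<psi> \<eta> = (mon B \<eta> * \<psi>0 \<eta> + 1 * (mon (insert x B) \<eta> * \<psi>1 \<eta>))
        + (- 1) * (mon (insert x B) \<eta> * \<psi>0 \<eta>)" for \<eta>
    proof (cases "\<eta> x")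
      case True
      then have "\<eta>(x := True) = \<eta>" by (auto simp: fun_eq_iff)
      then show ?thesis using True by (simp add: \<psi>1_def mon_def)
    next
      case False
      then have "\<eta>(x := False) = \<eta>" by (auto simp: fun_eq_iff)
      then show ?thesis using False by (simp add: \<psi>0_def mon_def)
    qed
    with comb[OF comb[OF Q(1,2), of 1] Q(3), of "- 1"] show ?case by presburger
  qed
  from assms(1) obtain A where "finite A" "depends_only_on \<phi> A" by (auto simp: local_function_def)
  from *[OF this(1) _ this(2), of "{}"] show ?thesis by simp
qed

section \<open>Bernoulli means and Riemann sums\<close>

abbreviation bern :: "real \<Rightarrow> config measure" where
  "bern \<rho> \<equiv> Pi\<^sub>M UNIV (\<lambda>_. measure_pmf (bernoulli_pmf \<rho>))"

lemma product_prob_space_bern: "product_prob_space (\<lambda>_::int. measure_pmf (bernoulli_pmf \<rho>))"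
  by (intro product_prob_spaceI prob_space_measure_pmf)

lemma prob_space_bern: "prob_space (bern \<rho>)"
  by (intro prob_space_PiM prob_space_measure_pmf)

lemma mon_eq_indicator:
  "mon B = indicator (prod_emb UNIV (\<lambda>_. measure_pmf (bernoulli_pmf \<rho>)) B (B \<rightarrow>\<^sub>E {True}))"
  by (auto simp: mon_def fun_eq_iff indicator_def prod_emb_def PiE_iff)

lemma mon_measurable:
  assumes "finite B"
  shows "mon B \<in> borel_measurable (bern \<rho>)"
  unfolding mon_eq_indicator[of B \<rho>]
  by (intro borel_measurable_indicator sets_PiM_I) (use assms in auto)

lemma bernoulli_mean_mon:
  assumes "finite B" "0 \<le> \<rho>" "\<rho> \<le> 1"
  shows "bernoulli_mean (mon B) \<rho> = \<rho> ^ card B"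
proof -
  interpret product_prob_space "\<lambda>_::int. measure_pmf (bernoulli_pmf \<rho>)" UNIV
    by (rule product_prob_space_bern)
  have "bernoulli_mean (mon B) \<rho> = measure (bern \<rho>) (prod_emb UNIV (\<lambda>_. measure_pmf (bernoulli_pmf \<rho>)) B (B \<rightarrow>\<^sub>E {True}))"
    unfolding bernoulli_mean_def mon_eq_indicator[of B \<rho>] by (simp add: space_PiM)
  also have "\<dots> = (\<Prod>i\<in>B. measure (measure_pmf (bernoulli_pmf \<rho>)) {True})"
    using assms by (intro measure_PiM_emb) auto
  also have "\<dots> = \<rho> ^ card B" using assms by (simp add: measure_pmf_single)
  finally show ?thesis .
qed

lemma bernoulli_mean_comb:
  assumes "f \<in> borel_measurable (bern \<rho>)" "g \<in> borel_measurable (bern \<rho>)"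
    and "\<And>\<eta>. \<bar>f \<eta>\<bar> \<le> F" "\<And>\<eta>. \<bar>g \<eta>\<bar> \<le> G"
  shows "bernoulli_mean (\<lambda>\<eta>. f \<eta> + a * g \<eta>) \<rho> = bernoulli_mean f \<rho> + a * bernoulli_mean g \<rho>"
proof -
  interpret prob_space "bern \<rho>" by (rule prob_space_bern)
  have "integrable (bern \<rho>) f" using assms by (intro integrable_const_bound[where B = F]) auto
  moreover have "integrable (bern \<rho>) g" using assms by (intro integrable_const_bound[where B = G]) auto
  ultimately show ?thesis by (simp add: bernoulli_mean_def)
qed

text \<open>On each of the 2N cells the mean value theorem for the antiderivative \<open>I\<close>
  gives a value of F inside the cell, which uniform continuity compares with the left end
  point.\<close>

lemma riemann_sum_box:
  fixes F :: "real \<Rightarrow> real"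
  assumes "continuous_on {-1..1} F"
  shows "(\<lambda>N. 1 / real N * (\<Sum>x\<in>box N. F (real_of_int x / real N))) \<longlonglongrightarrow> (LBINT y:{-1..1}. F y)"
proof -
  define I where "I x = integral {-1..x} F" for x
  have der: "(I has_real_derivative F x) (at x within {-1..1})" if "x \<in> {-1..1}" for x
    unfolding I_def using integral_has_real_derivative[OF assms that] .
  have "set_integrable lborel {-1..1} F"
    unfolding set_integrable_def using borel_integrable_compact[OF _ assms] by simp
  then have LB: "(LBINT y:{-1..1}. F y) = I 1"
    using set_borel_integral_eq_integral(2) by (simp add: I_def)
  obtain B where B: "\<forall>x\<in>{-1..1}. \<bar>F x\<bar> \<le> B"
    using compact_imp_bounded[OF compact_continuous_image[OF assms]] by (auto simp: bounded_iff)
  have uc: "uniformly_continuous_on {-1..1} F" using assms by (intro compact_uniformly_continuous) auto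
  show ?thesis
  proof (rule LIMSEQ_I)
    fix e :: real assume e: "0 < e"
    then obtain d where d: "d > 0" "\<And>x y. x \<in> {-1..1} \<Longrightarrow> y \<in> {-1..1} \<Longrightarrow> dist x y < d \<Longrightarrow> dist (F x) (F y) < e / 4"
      using uc unfolding uniformly_continuous_on_def by (metis divide_pos_pos zero_less_numeral dist_commute)
    obtain n1 :: nat where n1: "1 / d < real n1" using reals_Archimedean2 by blast
    obtain n2 :: nat where n2: "2 * B / e < real n2" using reals_Archimedean2 by blast
    show "\<exists>no. \<forall>N\<ge>no. norm (1 / real N * (\<Sum>x\<in>box N. F (real_of_int x / real N)) - (LBINT y:{-1..1}. F y)) < e"
    proof (intro exI allI impI)
      fix N assume N: "Suc (max n1 n2) \<le> N"
      then have N0: "0 < real N" by simp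
      define h where "h x = real_of_int x / real N" for x :: int
      have h1: "h (x + 1) = h x + 1 / real N" for x by (simp add: h_def add_divide_distrib)
      have "1 / d < real N" using N n1 by linarith
      then have small: "1 / real N < d" using d(1) N0 by (simp add: field_simps)
      \<comment> \<open>The 2N cells together contribute e/2, which leaves e/2 for the end
        point.\<close>
      have step: "\<bar>I (h (x + 1)) - I (h x) - F (h x) / real N\<bar> \<le> e / 4 / real N" if "x \<in> {- int N..int N - 1}" for x
      proof -
        have hx: "-1 \<le> h x" "h (x + 1) \<le> 1" using that N0 by (auto simp: h_def field_simps)
        have lt: "h x < h (x + 1)" using N0 by (simp add: h1)
        have "\<exists>z\<in>{h x<..<h (x + 1)}. I (h (x + 1)) - I (h x) = (h (x + 1) - h x) * F z"
        proof (rule mvt_simple[OF lt, of I "\<lambda>z v. v * F z", simplified])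
          fix z assume "h x \<le> z" "z \<le> h (x + 1)"
          then have "(I has_derivative (\<lambda>v. F z * v)) (at z within {-1..1})"
            using der[of z] hx by (auto simp: has_field_derivative_def)
          then show "(I has_derivative (\<lambda>v. v * F z)) (at z within {h x..h (x + 1)})"
            using hx by (auto simp: mult.commute intro: has_derivative_subset)
        qed
        then obtain z where z: "h x < z" "z < h (x + 1)" "I (h (x + 1)) - I (h x) = (h (x + 1) - h x) * F z"
          by auto
        have "dist (F z) (F (h x)) < e / 4"
          using z hx small lt h1[of x] by (intro d) (auto simp: dist_real_def)
        then have "\<bar>F z - F (h x)\<bar> / real N \<le> e / 4 / real N" using divide_right_mono[of "\<bar>F z - F (h x)\<bar>" "e / 4" "real N"] by (simp add: dist_real_def)
        moreover have "I (h (x + 1)) - I (h x) - F (h x) / real N = (F z - F (h x)) / real N"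
          using z(3) by (simp add: h1 diff_divide_distrib)
        ultimately show ?thesis using N0 by simp
      qed
      have "I (h (int N)) - I (h (- int N)) = (\<Sum>x = - int N..int N - 1. I (h (x + 1)) - I (h x))"
        by (rule sum_int_telescope[symmetric]) simp
      moreover have "I (h (int N)) = I 1" "I (h (- int N)) = 0" using N0 by (simp_all add: h_def I_def)
      ultimately have tele: "I 1 = (\<Sum>x = - int N..int N - 1. I (h (x + 1)) - I (h x))" by simp
      \<comment> \<open>The box has one site more than there are cells; its last site adds F 1 /
        N.\<close>
      have bx: "box N = insert (int N) {- int N..int N - 1}" by (auto simp: box_def)
      have "1 / real N * (\<Sum>x\<in>box N. F (h x)) = F 1 / real N + (\<Sum>x = - int N..int N - 1. F (h x) / real N)"
        unfolding bx using N0 by (simp add: h_def sum_divide_distrib add_divide_distrib)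
      then have "\<bar>1 / real N * (\<Sum>x\<in>box N. F (h x)) - I 1\<bar> =
          \<bar>F 1 / real N - (\<Sum>x = - int N..int N - 1. I (h (x + 1)) - I (h x) - F (h x) / real N)\<bar>"
        unfolding tele by (simp add: sum_subtractf)
      also have "\<dots> \<le> \<bar>F 1\<bar> / real N + (\<Sum>x = - int N..int N - 1. \<bar>I (h (x + 1)) - I (h x) - F (h x) / real N\<bar>)"
        by (rule order_trans[OF abs_triangle_ineq4]) (use N0 in \<open>auto intro: sum_abs\<close>)
      also have "\<dots> \<le> B / real N + (\<Sum>x = - int N..int N - 1. e / 4 / real N)"
        using bspec[OF B, of 1] N0 step by (intro add_mono sum_mono divide_right_mono) auto
      also have "\<dots> = B / real N + e / 2" using N0 by simp
      also have "\<dots> < e"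
      proof -
        have "2 * B / e < real N" using N n2 by linarith
        then show ?thesis using e N0 by (simp add: field_simps)
      qed
      finally show "norm (1 / real N * (\<Sum>x\<in>box N. F (real_of_int x / real N)) - (LBINT y:{-1..1}. F y)) < e"
        unfolding LB h_def by simp
    qed
  qed
qed

section \<open>Second moments of spatial averages\<close>

lemma card_box: "card (box N) = 2 * N + 1"
  by (simp add: box_def nat_add_distrib nat_mult_distrib)

lemma card_box_margin: "card {x \<in> box N. \<not> \<bar>x\<bar> \<le> int N - int m} \<le> 2 * m"
proof -
  have "{x \<in> box N. \<not> \<bar>x\<bar> \<le> int N - int m} \<subseteq> {- int N..<- int N + int m} \<union> {int N - int m<..int N}"
    by (auto simp: box_def)
  then have "card {x \<in> box N. \<not> \<bar>x\<bar> \<le> int N - int m} \<le> card ({- int N..<- int N + int m} \<union> {int N - int m<..int N})"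
    by (intro card_mono) auto
  also have "\<dots> \<le> 2 * m" by (rule order_trans[OF card_Un_le]) simp
  finally show ?thesis .
qed

text \<open>The variance of the absolute value is nonnegative.\<close>

lemma expectation_abs_le_sqrt:
  assumes "finite (set_pmf q)"
  shows "measure_pmf.expectation q (\<lambda>\<eta>. \<bar>Z \<eta>\<bar>) \<le> sqrt (measure_pmf.expectation q (\<lambda>\<eta>. (Z \<eta>)\<^sup>2))"
proof (rule real_le_rsqrt)
  have [simp]: "integrable (measure_pmf q) f" for f :: "_ \<Rightarrow> real"
    using assms by (rule integrable_measure_pmf_finite)
  show "(measure_pmf.expectation q (\<lambda>\<eta>. \<bar>Z \<eta>\<bar>))\<^sup>2 \<le> measure_pmf.expectation q (\<lambda>\<eta>. (Z \<eta>)\<^sup>2)"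
    using measure_pmf.variance_positive[of q "\<lambda>\<eta>. \<bar>Z \<eta>\<bar>"] measure_pmf.variance_eq[of q "\<lambda>\<eta>. \<bar>Z \<eta>\<bar>"] by simp
qed

text \<open>The second moment is a double sum over pairs of sites. Pairs that are far apart and away
  from the ends contribute at most \<open>\<delta>\<close>; the others number only order mN among
  N^2 and are bounded trivially.\<close>

lemma weighted_average_L1:
  fixes q :: "'a pmf" and Y :: "int \<Rightarrow> 'a \<Rightarrow> real"
  assumes fin: "finite (set_pmf q)" and N: "0 < N"
    and g: "\<And>x. x \<in> box N \<Longrightarrow> \<bar>g x\<bar> \<le> \<Gamma>"
    and Y: "\<And>x \<eta>. x \<in> box N \<Longrightarrow> \<bar>Y x \<eta>\<bar> \<le> 1"
    and "0 \<le> \<delta>"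
    and corr: "\<And>x x'. \<bar>x\<bar> \<le> int N - int m \<Longrightarrow> \<bar>x'\<bar> \<le> int N - int m \<Longrightarrow> 2 * int m < \<bar>x - x'\<bar> \<Longrightarrow>
      \<bar>measure_pmf.expectation q (\<lambda>\<eta>. Y x \<eta> * Y x' \<eta>)\<bar> \<le> \<delta>"
  shows "measure_pmf.expectation q (\<lambda>\<eta>. \<bar>1 / real N * (\<Sum>x\<in>box N. g x * Y x \<eta>)\<bar>)
    \<le> sqrt (\<Gamma>\<^sup>2 * (9 * \<delta> + 3 * (8 * real m + 1) / real N))"
proof -
  have int [simp]: "integrable (measure_pmf q) f" for f :: "_ \<Rightarrow> real"
    using fin by (rule integrable_measure_pmf_finite)
  define b where "b x = (of_bool (\<not> \<bar>x\<bar> \<le> int N - int m) :: real)" for x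
  define c where "c x x' = (of_bool (\<bar>x - x'\<bar> \<le> 2 * int m) :: real)" for x x'
  have G0: "0 \<le> \<Gamma>" using g[of 0] by (force simp: box_def)
  have sb: "(\<Sum>x\<in>box N. b x) \<le> 2 * real m"
  proof -
    have "(\<Sum>x\<in>box N. b x) = real (card {x \<in> box N. \<not> \<bar>x\<bar> \<le> int N - int m})"
      unfolding b_def by (simp add: Int_def)
    then show ?thesis using card_box_margin[of N m] by linarith
  qed
  have sc: "(\<Sum>x'\<in>box N. c x x') \<le> 4 * real m + 1" for x
  proof -
    have "(\<Sum>x'\<in>box N. c x x') = real (card {x' \<in> box N. \<bar>x - x'\<bar> \<le> 2 * int m})"
      unfolding c_def by (simp add: Int_def)
    also have "card {x' \<in> box N. \<bar>x - x'\<bar> \<le> 2 * int m} \<le> card {x - 2 * int m..x + 2 * int m}"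
      by (intro card_mono) auto
    finally show ?thesis by simp
  qed
  have pair: "\<bar>measure_pmf.expectation q (\<lambda>\<eta>. Y x \<eta> * Y x' \<eta>)\<bar> \<le> \<delta> + (b x + b x' + c x x')"
    if "x \<in> box N" "x' \<in> box N" for x x'
  proof (cases "\<bar>x\<bar> \<le> int N - int m \<and> \<bar>x'\<bar> \<le> int N - int m \<and> 2 * int m < \<bar>x - x'\<bar>")
    case True
    then show ?thesis using corr[of x x'] by (simp add: b_def c_def)
  next
    case False
    have "\<bar>Y x \<eta> * Y x' \<eta>\<bar> \<le> 1" for \<eta>
      unfolding abs_mult using Y that mult_mono[of "\<bar>Y x \<eta>\<bar>" 1 "\<bar>Y x' \<eta>\<bar>" 1] by simp
    then have "\<bar>measure_pmf.expectation q (\<lambda>\<eta>. Y x \<eta> * Y x' \<eta>)\<bar> \<le> 1"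
      by (intro order_trans[OF integral_abs_bound] measure_pmf.integral_le_const) auto
    moreover have "1 \<le> b x + b x' + c x x'" using False by (auto simp: b_def c_def)
    ultimately show ?thesis using \<open>0 \<le> \<delta>\<close> by linarith
  qed
  have sq: "(1 / real N * (\<Sum>x\<in>box N. g x * Y x \<eta>))\<^sup>2 =
      1 / (real N)\<^sup>2 * (\<Sum>x\<in>box N. \<Sum>x'\<in>box N. g x * g x' * (Y x \<eta> * Y x' \<eta>))" for \<eta>
    unfolding power_mult_distrib power2_eq_square[of "sum _ _"] sum_product
    by (simp add: power_divide mult.assoc mult.left_commute)
  have "measure_pmf.expectation q (\<lambda>\<eta>. (1 / real N * (\<Sum>x\<in>box N. g x * Y x \<eta>))\<^sup>2)
      = 1 / (real N)\<^sup>2 * (\<Sum>x\<in>box N. \<Sum>x'\<in>box N. g x * g x' * measure_pmf.expectation q (\<lambda>\<eta>. Y x \<eta> * Y x' \<eta>))"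
    unfolding sq by simp
  also have "\<dots> \<le> 1 / (real N)\<^sup>2 * (\<Sum>x\<in>box N. \<Sum>x'\<in>box N. \<Gamma>\<^sup>2 * (\<delta> + (b x + b x' + c x x')))"
  proof (intro mult_left_mono sum_mono)
    fix x x' assume xx: "x \<in> box N" "x' \<in> box N"
    have "g x * g x' * measure_pmf.expectation q (\<lambda>\<eta>. Y x \<eta> * Y x' \<eta>)
        \<le> \<bar>g x\<bar> * \<bar>g x'\<bar> * \<bar>measure_pmf.expectation q (\<lambda>\<eta>. Y x \<eta> * Y x' \<eta>)\<bar>"
      by (metis abs_ge_self abs_mult)
    also have "\<dots> \<le> \<Gamma> * \<Gamma> * (\<delta> + (b x + b x' + c x x'))"
      using g xx pair[OF xx] G0 by (intro mult_mono) auto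
    finally show "g x * g x' * measure_pmf.expectation q (\<lambda>\<eta>. Y x \<eta> * Y x' \<eta>) \<le> \<Gamma>\<^sup>2 * (\<delta> + (b x + b x' + c x x'))"
      by (simp add: power2_eq_square)
  qed auto
  also have "\<dots> = 1 / (real N)\<^sup>2 * (\<Gamma>\<^sup>2 * (\<Sum>x\<in>box N. \<Sum>x'\<in>box N. \<delta> + (b x + b x' + c x x')))"
    by (simp add: sum_distrib_left)
  also have "\<dots> \<le> 1 / (real N)\<^sup>2 * (\<Gamma>\<^sup>2 * (9 * (real N)\<^sup>2 * \<delta> + 3 * real N * (8 * real m + 1)))"
  proof (intro mult_left_mono)
    have "(\<Sum>x\<in>box N. \<Sum>x'\<in>box N. \<delta> + (b x + b x' + c x x'))
        = (2 * real N + 1) * ((2 * real N + 1) * \<delta>) + 2 * ((2 * real N + 1) * (\<Sum>x\<in>box N. b x)) + (\<Sum>x\<in>box N. \<Sum>x'\<in>box N. c x x')"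
      by (simp add: sum.distrib card_box sum_distrib_left[symmetric] sum_distrib_right[symmetric] algebra_simps)
    also have "\<dots> \<le> (2 * real N + 1) * ((2 * real N + 1) * \<delta>) + 2 * ((2 * real N + 1) * (2 * real m)) + (\<Sum>x\<in>box N. 4 * real m + 1)"
      using sb sc by (intro add_mono mult_left_mono sum_mono) auto
    also have "\<dots> = (2 * real N + 1) * ((2 * real N + 1) * \<delta>) + (2 * real N + 1) * (8 * real m + 1)"
      by (simp add: card_box algebra_simps)
    \<comment> \<open>Per site the exceptional pairs amount to twice 2m, from either site being near
      an end, plus 4m + 1 close sites. The factors 3 and 9 come from 2N + 1 being at most
      3N.\<close>
    also have "\<dots> \<le> (3 * real N) * ((3 * real N) * \<delta>) + (3 * real N) * (8 * real m + 1)"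
      using N \<open>0 \<le> \<delta>\<close> by (intro add_mono mult_mono mult_right_mono) auto
    finally show "(\<Sum>x\<in>box N. \<Sum>x'\<in>box N. \<delta> + (b x + b x' + c x x')) \<le> 9 * (real N)\<^sup>2 * \<delta> + 3 * real N * (8 * real m + 1)"
      by (simp add: power2_eq_square mult_ac)
  qed auto
  also have "\<dots> = \<Gamma>\<^sup>2 * (9 * \<delta> + 3 * (8 * real m + 1) / real N)"
    using N by (simp add: field_simps power2_eq_square)
  finally show ?thesis
    by (intro order_trans[OF expectation_abs_le_sqrt[OF fin]] real_sqrt_le_mono)
qed

lemma rho_bar_bounds:
  assumes "y \<in> {-1..1}" "0 \<le> \<rho>m s" "\<rho>m s \<le> 1" "0 \<le> \<rho>p s" "\<rho>p s \<le> 1"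
  shows "0 \<le> rho_bar \<rho>m \<rho>p y s" "rho_bar \<rho>m \<rho>p y s \<le> 1"
proof -
  have eq: "rho_bar \<rho>m \<rho>p y s = \<rho>p s * ((1 + y) / 2) + \<rho>m s * ((1 - y) / 2)"
    by (simp add: rho_bar_def field_simps)
  show "0 \<le> rho_bar \<rho>m \<rho>p y s" unfolding eq using assms by simp
  have "rho_bar \<rho>m \<rho>p y s \<le> 1 * ((1 + y) / 2) + 1 * ((1 - y) / 2)"
    unfolding eq using assms by (intro add_mono mult_right_mono) auto
  also have "\<dots> = 1" by (simp add: field_simps)
  finally show "rho_bar \<rho>m \<rho>p y s \<le> 1" .
qed

lemma box_scaled:
  assumes "x \<in> box N" "0 < N"
  shows "real_of_int x / real N \<in> {-1..1}"
  using assms by (auto simp: box_def field_simps)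

text \<open>Two discrepancies of order 1/N: the displacement by z along a profile of slope at most
  1/(2N + 1), and the reservoirs at distance N + 1/2 rather than N.\<close>

lemma profile_approx:
  assumes "0 < N" "x \<in> box N" "\<bar>z\<bar> \<le> int m"
    and "0 \<le> \<rho>m s" "\<rho>m s \<le> 1" "0 \<le> \<rho>p s" "\<rho>p s \<le> 1"
  shows "\<bar>profile (\<rho>m s) (\<rho>p s) N (z + x) - rho_bar \<rho>m \<rho>p (real_of_int x / real N) s\<bar> \<le> (real m + 1) / real N"
proof -
  have N: "1 \<le> real N" using assms(1) by simp
  have z: "\<bar>real_of_int z\<bar> \<le> real m" using assms(3) by linarith
  have x: "\<bar>real_of_int x\<bar> \<le> real N" using assms(2) by (auto simp: box_def abs_le_iff)
  have "profile (\<rho>m s) (\<rho>p s) N (z + x) - rho_bar \<rho>m \<rho>p (real_of_int x / real N) s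
      = (\<rho>p s - \<rho>m s) * ((real_of_int z + real_of_int x) / (2 * real N + 1) - real_of_int x / (2 * real N))"
    by (simp add: profile_def rho_bar_def algebra_simps add_divide_distrib diff_divide_distrib)
  also have "(real_of_int z + real_of_int x) / (2 * real N + 1) - real_of_int x / (2 * real N)
      = (2 * real N * real_of_int z - real_of_int x) / ((2 * real N + 1) * (2 * real N))"
    using N by (subst diff_frac_eq) (auto simp: algebra_simps)
  finally have "\<bar>profile (\<rho>m s) (\<rho>p s) N (z + x) - rho_bar \<rho>m \<rho>p (real_of_int x / real N) s\<bar>
      = \<bar>\<rho>p s - \<rho>m s\<bar> * (\<bar>2 * real N * real_of_int z - real_of_int x\<bar> / ((2 * real N + 1) * (2 * real N)))"
    using N by (simp add: abs_mult)
  also have "\<dots> \<le> 1 * ((2 * real N * real m + real N) / (real N * (2 * real N)))"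
  proof (intro mult_mono frac_le)
    have "\<bar>2 * real N * real_of_int z - real_of_int x\<bar> \<le> 2 * real N * \<bar>real_of_int z\<bar> + \<bar>real_of_int x\<bar>"
      by (rule order_trans[OF abs_triangle_ineq4]) (simp add: abs_mult)
    also have "\<dots> \<le> 2 * real N * real m + real N" using z x by (intro add_mono mult_left_mono) auto
    finally show "\<bar>2 * real N * real_of_int z - real_of_int x\<bar> \<le> 2 * real N * real m + real N" .
  qed (use N assms in auto)
  also have "\<dots> \<le> (real m + 1) / real N" using N by (simp add: field_simps)
  finally show ?thesis .
qed

lemma abs_prod_diff_le:
  fixes f :: "'i \<Rightarrow> real"
  assumes "\<And>i. i \<in> I \<Longrightarrow> \<bar>f i\<bar> \<le> 1" "\<bar>p\<bar> \<le> 1" "\<And>i. i \<in> I \<Longrightarrow> \<bar>f i - p\<bar> \<le> e"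
  shows "\<bar>(\<Prod>i\<in>I. f i) - p ^ card I\<bar> \<le> real (card I) * e"
proof -
  have "\<bar>(\<Prod>i\<in>I. f i) - (\<Prod>i\<in>I. p)\<bar> \<le> (\<Sum>i\<in>I. \<bar>f i - p\<bar>)"
    using norm_prod_diff[of I f "\<lambda>_. p"] assms by simp
  also have "\<dots> \<le> real (card I) * e" using assms by (intro sum_bounded_above) auto
  finally show ?thesis by simp
qed

lemma shift_mon: "shift x (mon B) = mon ((\<lambda>z. z + x) ` B)"
  by (auto simp: shift_def mon_def fun_eq_iff)

lemma LIMSEQ_zero_bound:
  fixes f g :: "nat \<Rightarrow> real"
  assumes "g \<longlonglongrightarrow> 0" "\<And>N. 0 < N \<Longrightarrow> 0 \<le> f N" "\<And>N. 0 < N \<Longrightarrow> f N \<le> g N"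
  shows "f \<longlonglongrightarrow> 0"
  by (rule tendsto_sandwich[OF _ _ tendsto_const assms(1)])
    (use assms(2,3) in \<open>auto simp: eventually_sequentially intro!: exI[of _ 1]\<close>)

section \<open>Convergence at one fixed time\<close>

locale local_equilibrium =
  fixes \<rho>m \<rho>p :: "real \<Rightarrow> real" and s :: real and q :: "nat \<Rightarrow> config pmf"
  assumes rm: "0 \<le> \<rho>m s" "\<rho>m s \<le> 1" and rp: "0 \<le> \<rho>p s" "\<rho>p s \<le> 1"
    and fin: "\<And>N. 0 < N \<Longrightarrow> finite (set_pmf (q N))"
    and est: "\<And>K. 0 < K \<Longrightarrow> \<exists>\<epsilon>. \<epsilon> \<longlonglongrightarrow> 0 \<and> (\<forall>N>0. \<forall>C\<subseteq>box N. card C \<le> K \<longrightarrow>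
      \<bar>measure_pmf.expectation (q N) (mon C) - (\<Prod>y\<in>C. profile (\<rho>m s) (\<rho>p s) N y)\<bar> \<le> \<epsilon> N)"
begin

text \<open>The sum runs over the whole box, unlike in \<open>empirical_average\<close>, whose range
  of summation depends on the observable. This makes the average linear in \<phi>, as the induction
  over local functions requires.\<close>

definition average_converges :: "(real \<Rightarrow> real) \<Rightarrow> (config \<Rightarrow> real) \<Rightarrow> bool" where
  "average_converges G \<phi> \<longleftrightarrow>
     (\<lambda>N. measure_pmf.expectation (q N) (\<lambda>\<eta>.
        \<bar>1 / real N * (\<Sum>x\<in>box N. G (real_of_int x / real N) * shift x \<phi> \<eta>)
         - (LBINT y:{-1..1}. G y * bernoulli_mean \<phi> (rho_bar \<rho>m \<rho>p y s))\<bar>)) \<longlonglongrightarrow> 0"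

text \<open>Centring each translate by the n-th power of the macroscopic density splits the error
  into a fluctuation, small because well separated translates factorise, and a deterministic Riemann
  sum error.\<close>

lemma average_converges_mon:
  assumes B: "finite B" and G: "continuous_on {-1..1} G"
  shows "average_converges G (mon B)"
proof -
  define n where "n = card B"
  define p where "p N x = rho_bar \<rho>m \<rho>p (real_of_int x / real N) s" for N x
  define T where "T x = (\<lambda>z. z + x) ` B" for x
  define Y where "Y N x \<eta> = mon (T x) \<eta> - p N x ^ n" for N x \<eta>
  define r where "r = profile (\<rho>m s) (\<rho>p s)"
  define I where "I = (LBINT y:{-1..1}. G y * rho_bar \<rho>m \<rho>p y s ^ n)"
  obtain m :: nat where m: "\<And>z. z \<in> B \<Longrightarrow> \<bar>z\<bar> \<le> int m"
  proof (rule that)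
    fix z assume "z \<in> B"
    then have "nat \<bar>z\<bar> \<le> (\<Sum>z\<in>B. nat \<bar>z\<bar>)" using B by (intro member_le_sum) auto
    then show "\<bar>z\<bar> \<le> int (\<Sum>z\<in>B. nat \<bar>z\<bar>)" by linarith
  qed
  obtain \<Gamma> where \<Gamma>: "\<forall>y\<in>{-1..1}. \<bar>G y\<bar> \<le> \<Gamma>"
    using compact_imp_bounded[OF compact_continuous_image[OF G]] by (auto simp: bounded_iff)
  \<comment> \<open>Two disjoint translates of \<open>B\<close> have 2n sites; adding 1 keeps the
    bound positive when \<open>B\<close> is empty.\<close>
  obtain \<epsilon> where \<epsilon>: "\<epsilon> \<longlonglongrightarrow> 0"
    and est\<epsilon>: "\<And>N C. 0 < N \<Longrightarrow> C \<subseteq> box N \<Longrightarrow> card C \<le> 2 * n + 1 \<Longrightarrow>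
       \<bar>measure_pmf.expectation (q N) (mon C) - (\<Prod>y\<in>C. r N y)\<bar> \<le> \<epsilon> N"
    using est[of "2 * n + 1"] by (auto simp: r_def)
  \<comment> \<open>One translate costs n(m + 1)/N when the profile is replaced by the macroscopic
    density; the factor 2 is for a pair of translates.\<close>
  define d where "d N = 2 * (real n * ((real m + 1) / real N))" for N
  define \<delta> where "\<delta> N = 3 * (\<epsilon> N + d N)" for N
  have p01: "0 \<le> p N x" "p N x \<le> 1" if "x \<in> box N" "0 < N" for N x
    unfolding p_def using rho_bar_bounds[of _ \<rho>m s \<rho>p, OF _ rm rp] box_scaled[OF that] by auto
  have pn: "0 \<le> p N x ^ n" "p N x ^ n \<le> 1" if "x \<in> box N" "0 < N" for N x
    using p01[OF that] by (auto intro: power_le_one)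
  have cardT: "card (T x) = n" for x
    unfolding T_def n_def by (rule card_image) (auto simp: inj_on_def)
  have finT: "finite (T x)" for x using B by (simp add: T_def)
  have bound: "measure_pmf.expectation (q N) (\<lambda>\<eta>.
      \<bar>1 / real N * (\<Sum>x\<in>box N. G (real_of_int x / real N) * shift x (mon B) \<eta>) - I\<bar>)
      \<le> sqrt (\<Gamma>\<^sup>2 * (9 * \<delta> N + 3 * (8 * real m + 1) / real N))
        + \<bar>1 / real N * (\<Sum>x\<in>box N. G (real_of_int x / real N) * rho_bar \<rho>m \<rho>p (real_of_int x / real N) s ^ n) - I\<bar>"
    if N: "0 < N" for N
  proof -
    have int [simp]: "integrable (measure_pmf (q N)) f" for f :: "_ \<Rightarrow> real"
      using fin[OF N] by (rule integrable_measure_pmf_finite)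
    define g where "g x = G (real_of_int x / real N)" for x
    define R where "R = 1 / real N * (\<Sum>x\<in>box N. g x * p N x ^ n)"
    \<comment> \<open>For the empty set the estimate compares 1 with 1.\<close>
    have "0 \<le> \<epsilon> N" using est\<epsilon>[OF N, of "{}"] by auto
    then have \<delta>0: "0 \<le> \<delta> N" by (simp add: \<delta>_def d_def)
    have main: "measure_pmf.expectation (q N) (\<lambda>\<eta>. \<bar>1 / real N * (\<Sum>x\<in>box N. g x * Y N x \<eta>)\<bar>)
        \<le> sqrt (\<Gamma>\<^sup>2 * (9 * \<delta> N + 3 * (8 * real m + 1) / real N))"
    proof (rule weighted_average_L1[OF fin[OF N] N _ _ \<delta>0])
      show "\<bar>g x\<bar> \<le> \<Gamma>" if "x \<in> box N" for x
        using \<Gamma> box_scaled[OF that N] by (auto simp: g_def)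
      show "\<bar>Y N x \<eta>\<bar> \<le> 1" if "x \<in> box N" for x \<eta>
        using pn[OF that N] mon_bounds[of "T x" \<eta>] by (auto simp: Y_def)
    next
      fix x x' assume xx: "\<bar>x\<bar> \<le> int N - int m" "\<bar>x'\<bar> \<le> int N - int m" "2 * int m < \<bar>x - x'\<bar>"
      have bx: "x \<in> box N" "x' \<in> box N" using xx by (auto simp: box_def)
      have Tb: "T y \<subseteq> box N" if "\<bar>y\<bar> \<le> int N - int m" for y
        using m that by (force simp: T_def box_def)
      \<comment> \<open>Each translate lies within distance m of its centre, so centres more than 2m
        apart give disjoint sets.\<close>
      have disj: "T x \<inter> T x' = {}"
      proof (rule ccontr)
        assume "T x \<inter> T x' \<noteq> {}"
        then obtain z w where "z \<in> B" "w \<in> B" "z + x = w + x'" by (auto simp: T_def)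
        then show False using m[of z] m[of w] xx(3) by linarith
      qed
      have pd: "\<bar>(\<Prod>z\<in>T y. r N z) - p N y ^ n\<bar> \<le> d N / 2" if y: "\<bar>y\<bar> \<le> int N - int m" for y
      proof -
        have yb: "y \<in> box N" using y by (auto simp: box_def)
        have "\<bar>(\<Prod>z\<in>T y. r N z) - p N y ^ card (T y)\<bar> \<le> real (card (T y)) * ((real m + 1) / real N)"
        proof (rule abs_prod_diff_le)
          fix z assume z: "z \<in> T y"
          show "\<bar>r N z\<bar> \<le> 1"
            unfolding r_def by (rule profile_abs_le) (use z Tb[OF y] rm rp in auto)
          show "\<bar>r N z - p N y\<bar> \<le> (real m + 1) / real N"
            using z m unfolding r_def p_def T_def by (auto intro!: profile_approx N yb rm rp)
        qed (use p01[OF yb N] in auto)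
        then show ?thesis by (simp add: cardT d_def)
      qed
      have d0: "0 \<le> d N" by (simp add: d_def)
      define u where "u C = measure_pmf.expectation (q N) (mon C)" for C
      have single: "\<bar>u (T y) - p N y ^ n\<bar> \<le> \<epsilon> N + d N" if y: "\<bar>y\<bar> \<le> int N - int m" for y
      proof -
        have "\<bar>u (T y) - (\<Prod>z\<in>T y. r N z)\<bar> \<le> \<epsilon> N"
          using est\<epsilon>[OF N Tb[OF y]] by (simp add: cardT u_def)
        then show ?thesis using pd[OF y] d0 by linarith
      qed
      have double: "\<bar>u (T x \<union> T x') - p N x ^ n * p N x' ^ n\<bar> \<le> \<epsilon> N + d N"
      proof -
        have "\<bar>u (T x \<union> T x') - (\<Prod>z\<in>T x. r N z) * (\<Prod>z\<in>T x'. r N z)\<bar> \<le> \<epsilon> N"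
          using est\<epsilon>[OF N, of "T x \<union> T x'"] Tb[OF xx(1)] Tb[OF xx(2)] finT disj
          by (simp add: card_Un_disjoint prod.union_disjoint cardT u_def)
        moreover have "\<bar>(\<Prod>z\<in>T x. r N z) * (\<Prod>z\<in>T x'. r N z) - p N x ^ n * p N x' ^ n\<bar> \<le> d N / 2 + d N / 2"
        proof -
          define a b where "a = (\<Prod>z\<in>T x. r N z)" and "b = (\<Prod>z\<in>T x'. r N z)"
          have "\<bar>b\<bar> \<le> 1" unfolding b_def abs_prod
            by (rule prod_le_1) (use Tb[OF xx(2)] rm rp in \<open>auto simp: r_def intro!: profile_abs_le\<close>)
          have "a * b - p N x ^ n * p N x' ^ n = (a - p N x ^ n) * b + p N x ^ n * (b - p N x' ^ n)"
            by (simp add: algebra_simps)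
          also have "\<bar>\<dots>\<bar> \<le> \<bar>a - p N x ^ n\<bar> * \<bar>b\<bar> + \<bar>p N x ^ n\<bar> * \<bar>b - p N x' ^ n\<bar>"
            by (rule order_trans[OF abs_triangle_ineq]) (simp add: abs_mult)
          also have "\<dots> \<le> d N / 2 * 1 + 1 * (d N / 2)"
            using \<open>\<bar>b\<bar> \<le> 1\<close> d0 pd[OF xx(1)] pd[OF xx(2)] pn[OF bx(1) N]
            by (intro add_mono mult_mono) (auto simp: a_def b_def)
          finally show ?thesis by (simp add: a_def b_def)
        qed
        ultimately show ?thesis by linarith
      qed
      have YY: "Y N x \<eta> * Y N x' \<eta> = mon (T x \<union> T x') \<eta> - p N x' ^ n * mon (T x) \<eta> - p N x ^ n * mon (T x') \<eta>
          + p N x ^ n * p N x' ^ n" for \<eta>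
        by (simp add: Y_def mon_Un left_diff_distrib right_diff_distrib)
      have "measure_pmf.expectation (q N) (\<lambda>\<eta>. Y N x \<eta> * Y N x' \<eta>) =
          u (T x \<union> T x') - p N x' ^ n * u (T x) - p N x ^ n * u (T x') + p N x ^ n * p N x' ^ n"
        unfolding u_def YY by simp
      \<comment> \<open>Regrouped into three differences, each at most
        \<open>\<epsilon> N + d N\<close> because the prefactors lie in the unit interval; hence the
        3 in \<open>\<delta>\<close>.\<close>
      also have "\<dots> = (u (T x \<union> T x') - p N x ^ n * p N x' ^ n) - p N x' ^ n * (u (T x) - p N x ^ n) - p N x ^ n * (u (T x') - p N x' ^ n)"
        by (simp add: algebra_simps)
      finally have split: "measure_pmf.expectation (q N) (\<lambda>\<eta>. Y N x \<eta> * Y N x' \<eta>) = \<dots>" .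
      have small: "\<bar>c * (u (T y) - p N y ^ n)\<bar> \<le> \<epsilon> N + d N" if "0 \<le> c" "c \<le> 1" "\<bar>y\<bar> \<le> int N - int m" for c y
      proof -
        have "c * \<bar>u (T y) - p N y ^ n\<bar> \<le> 1 * \<bar>u (T y) - p N y ^ n\<bar>"
          using that by (intro mult_right_mono) auto
        then show ?thesis using single[OF that(3)] that(1) by (simp add: abs_mult)
      qed
      have "\<bar>a - b - c\<bar> \<le> 3 * e" if "\<bar>a\<bar> \<le> e" "\<bar>b\<bar> \<le> e" "\<bar>c\<bar> \<le> e" for a b c e :: real
        using that by linarith
      from this[OF double small[OF pn[OF bx(2) N] xx(1)] small[OF pn[OF bx(1) N] xx(2)]]
      show "\<bar>measure_pmf.expectation (q N) (\<lambda>\<eta>. Y N x \<eta> * Y N x' \<eta>)\<bar> \<le> \<delta> N"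
        by (simp only: split \<delta>_def)
    qed
    have eq: "1 / real N * (\<Sum>x\<in>box N. g x * shift x (mon B) \<eta>) - I
        = 1 / real N * (\<Sum>x\<in>box N. g x * Y N x \<eta>) + (R - I)" for \<eta>
      by (simp add: R_def Y_def shift_mon T_def right_diff_distrib sum_subtractf)
    have "measure_pmf.expectation (q N) (\<lambda>\<eta>. \<bar>1 / real N * (\<Sum>x\<in>box N. g x * shift x (mon B) \<eta>) - I\<bar>)
        \<le> measure_pmf.expectation (q N) (\<lambda>\<eta>. \<bar>1 / real N * (\<Sum>x\<in>box N. g x * Y N x \<eta>)\<bar> + \<bar>R - I\<bar>)"
      unfolding eq by (rule integral_mono[OF int int abs_triangle_ineq])
    also have "\<dots> = measure_pmf.expectation (q N) (\<lambda>\<eta>. \<bar>1 / real N * (\<Sum>x\<in>box N. g x * Y N x \<eta>)\<bar>) + \<bar>R - I\<bar>"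
      by simp
    finally show ?thesis using main by (simp add: g_def R_def p_def)
  qed
  have cont: "continuous_on {-1..1} (\<lambda>y. G y * rho_bar \<rho>m \<rho>p y s ^ n)"
    unfolding rho_bar_def by (intro continuous_intros G)
  have lim1: "(\<lambda>N. \<bar>1 / real N * (\<Sum>x\<in>box N. G (real_of_int x / real N) * rho_bar \<rho>m \<rho>p (real_of_int x / real N) s ^ n) - I\<bar>) \<longlonglongrightarrow> 0"
    using riemann_sum_box[OF cont] unfolding I_def
    by (intro tendsto_rabs_zero) (simp add: LIM_zero_iff)
  have "(\<lambda>N. c / real N) \<longlonglongrightarrow> 0" for c by (rule lim_const_over_n)
  from tendsto_mult_right[OF this[of "real m + 1"], of "2 * real n"] this[of "3 * (8 * real m + 1)"]
  have d0: "d \<longlonglongrightarrow> 0" and m0: "(\<lambda>N. 3 * (8 * real m + 1) / real N) \<longlonglongrightarrow> 0"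
    by (simp_all add: d_def[abs_def] mult_ac)
  have "(\<lambda>N. sqrt (\<Gamma>\<^sup>2 * (9 * \<delta> N + 3 * (8 * real m + 1) / real N))) \<longlonglongrightarrow> sqrt (\<Gamma>\<^sup>2 * (9 * (3 * (0 + 0)) + 0))"
    unfolding \<delta>_def
    by (intro tendsto_real_sqrt tendsto_mult tendsto_add tendsto_const \<epsilon> d0 m0)
  then have lim2: "(\<lambda>N. sqrt (\<Gamma>\<^sup>2 * (9 * \<delta> N + 3 * (8 * real m + 1) / real N))) \<longlonglongrightarrow> 0" by simp
  have "(LBINT y:{-1..1}. G y * bernoulli_mean (mon B) (rho_bar \<rho>m \<rho>p y s)) = I"
    unfolding I_def n_def
    using rho_bar_bounds[of _ \<rho>m s \<rho>p, OF _ rm rp] by (intro set_lebesgue_integral_cong) (auto simp: bernoulli_mean_mon[OF B])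
  then show ?thesis
    unfolding average_converges_def
    using LIMSEQ_zero_bound[OF tendsto_add_zero[OF lim2 lim1] _ bound] by simp
qed

end

text \<open>These properties hold for products and pass to linear combinations, so every local
  function has them. They make the Bernoulli mean linear and allow Riemann sums in the
  density.\<close>

definition regular_observable :: "(config \<Rightarrow> real) \<Rightarrow> bool" where
  "regular_observable \<phi> \<longleftrightarrow> (\<exists>M. \<forall>\<eta>. \<bar>\<phi> \<eta>\<bar> \<le> M) \<and> (\<forall>\<rho>. \<phi> \<in> borel_measurable (bern \<rho>)) \<and>
     continuous_on {0..1} (bernoulli_mean \<phi>)"

lemma regular_observable_mon:
  assumes "finite B"
  shows "regular_observable (mon B)"
proof -
  have "continuous_on {0..1} (\<lambda>\<rho>. \<rho> ^ card B :: real)" by (intro continuous_intros)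
  then have "continuous_on {0..1} (bernoulli_mean (mon B))"
    by (rule continuous_on_eq) (use bernoulli_mean_mon[OF assms] in auto)
  moreover have "\<exists>M. \<forall>\<eta>. \<bar>mon B \<eta>\<bar> \<le> M" using mon_bounds[of B] by (intro exI[of _ 1]) auto
  ultimately show ?thesis using mon_measurable[OF assms] by (auto simp: regular_observable_def)
qed

lemma bernoulli_mean_comb_regular:
  assumes "regular_observable f" "regular_observable g"
  shows "bernoulli_mean (\<lambda>\<eta>. f \<eta> + a * g \<eta>) \<rho> = bernoulli_mean f \<rho> + a * bernoulli_mean g \<rho>"
proof -
  obtain F G where "\<And>\<eta>. \<bar>f \<eta>\<bar> \<le> F" "\<And>\<eta>. \<bar>g \<eta>\<bar> \<le> G"
    using assms by (auto simp: regular_observable_def)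
  then show ?thesis
    using assms by (intro bernoulli_mean_comb) (auto simp: regular_observable_def)
qed

lemma regular_observable_comb:
  assumes "regular_observable f" "regular_observable g"
  shows "regular_observable (\<lambda>\<eta>. f \<eta> + a * g \<eta>)"
proof -
  obtain F G where FG: "\<And>\<eta>. \<bar>f \<eta>\<bar> \<le> F" "\<And>\<eta>. \<bar>g \<eta>\<bar> \<le> G"
    using assms by (auto simp: regular_observable_def)
  have "\<bar>f \<eta> + a * g \<eta>\<bar> \<le> F + \<bar>a\<bar> * G" for \<eta>
    by (rule order_trans[OF abs_triangle_ineq]) (use FG in \<open>auto simp: abs_mult intro!: add_mono mult_left_mono\<close>)
  moreover have "continuous_on {0..1} (bernoulli_mean (\<lambda>\<eta>. f \<eta> + a * g \<eta>))"
    using assms unfolding bernoulli_mean_comb_regular[OF assms, abs_def] regular_observable_def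
    by (intro continuous_intros) auto
  moreover have "(\<lambda>\<eta>. f \<eta> + a * g \<eta>) \<in> borel_measurable (bern \<rho>)" for \<rho>
    using assms unfolding regular_observable_def
    by (intro borel_measurable_add borel_measurable_times borel_measurable_const) auto
  ultimately show ?thesis unfolding regular_observable_def by blast
qed

lemma regular_observable_local:
  assumes "local_function \<phi>"
  shows "regular_observable \<phi>"
  using assms
  by (induction rule: local_function_induct) (erule regular_observable_mon, erule (1) regular_observable_comb)

lemma bernoulli_mean_abs_le:
  assumes "regular_observable \<phi>" "\<And>\<eta>. \<bar>\<phi> \<eta>\<bar> \<le> M"
  shows "\<bar>bernoulli_mean \<phi> \<rho>\<bar> \<le> M"
proof -
  interpret prob_space "bern \<rho>" by (rule prob_space_bern)
  have "\<phi> \<in> borel_measurable (bern \<rho>)" using assms(1) by (simp add: regular_observable_def)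
  then have int: "integrable (bern \<rho>) (\<lambda>\<eta>. \<bar>\<phi> \<eta>\<bar>)"
    using assms(2) by (intro integrable_const_bound[where B = M]) auto
  have "\<bar>bernoulli_mean \<phi> \<rho>\<bar> \<le> integral\<^sup>L (bern \<rho>) (\<lambda>\<eta>. \<bar>\<phi> \<eta>\<bar>)"
    unfolding bernoulli_mean_def by (rule integral_abs_bound)
  also have "\<dots> \<le> M" using int assms(2) by (intro integral_le_const) auto
  finally show ?thesis .
qed

lemma continuous_on_mean_rho_bar:
  assumes "regular_observable \<phi>" "continuous_on {-1..1} G"
    and "0 \<le> \<rho>m s" "\<rho>m s \<le> 1" "0 \<le> \<rho>p s" "\<rho>p s \<le> 1"
  shows "continuous_on {-1..1} (\<lambda>y. G y * bernoulli_mean \<phi> (rho_bar \<rho>m \<rho>p y s))"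
proof (rule continuous_on_mult[OF assms(2)], rule continuous_on_compose2[of "{0..1}" "bernoulli_mean \<phi>"])
  show "continuous_on {0..1} (bernoulli_mean \<phi>)" using assms(1) by (simp add: regular_observable_def)
  show "continuous_on {-1..1} (\<lambda>y. rho_bar \<rho>m \<rho>p y s)" unfolding rho_bar_def by (intro continuous_intros)
  show "(\<lambda>y. rho_bar \<rho>m \<rho>p y s) ` {-1..1} \<subseteq> {0..1}"
    using rho_bar_bounds[of _ \<rho>m s \<rho>p, OF _ assms(3-6)] by auto
qed

text \<open>Regularity is carried along in the induction, because linearity of the limiting integral
  depends on it.\<close>

lemma (in local_equilibrium) average_converges_local:
  assumes "local_function \<phi>" and G: "continuous_on {-1..1} G"
  shows "average_converges G \<phi>"
proof -
  have "regular_observable \<phi> \<and> average_converges G \<phi>"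
    using assms(1)
  proof (induction rule: local_function_induct)
    case (mon B)
    then show ?case by (simp add: regular_observable_mon average_converges_mon G)
  next
    case (comb f g a)
    define A where "A f N \<eta> = 1 / real N * (\<Sum>x\<in>box N. G (real_of_int x / real N) * shift x f \<eta>)" for f N \<eta>
    define J where "J f = (LBINT y:{-1..1}. G y * bernoulli_mean f (rho_bar \<rho>m \<rho>p y s))" for f
    have reg: "regular_observable f" "regular_observable g" using comb by auto
    have sint: "set_integrable lborel {-1..1} (\<lambda>y. G y * bernoulli_mean h (rho_bar \<rho>m \<rho>p y s))"
      if "regular_observable h" for h
      unfolding set_integrable_def
      using borel_integrable_compact[OF _ continuous_on_mean_rho_bar[where \<rho>m = \<rho>m and \<rho>p = \<rho>p and s = s, OF that G rm rp]] by simp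
    have sint': "set_integrable lborel {-1..1} (\<lambda>y. a * (G y * bernoulli_mean g (rho_bar \<rho>m \<rho>p y s)))"
      by (intro set_integrable_mult_right sint reg)
    have J: "J (\<lambda>\<eta>. f \<eta> + a * g \<eta>) = J f + a * J g"
    proof -
      have "J (\<lambda>\<eta>. f \<eta> + a * g \<eta>) = (LBINT y:{-1..1}. G y * bernoulli_mean f (rho_bar \<rho>m \<rho>p y s)
          + a * (G y * bernoulli_mean g (rho_bar \<rho>m \<rho>p y s)))"
        unfolding J_def bernoulli_mean_comb_regular[OF reg] by (simp add: algebra_simps)
      also have "\<dots> = J f + a * J g"
        unfolding J_def by (subst set_integral_add(2)) (use sint[OF reg(1)] sint' in simp_all)
      finally show ?thesis .
    qed
    have A: "A (\<lambda>\<eta>. f \<eta> + a * g \<eta>) N \<eta> = A f N \<eta> + a * A g N \<eta>" for N \<eta>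
      by (simp add: A_def shift_def sum.distrib sum_distrib_left algebra_simps)
    have le: "measure_pmf.expectation (q N) (\<lambda>\<eta>. \<bar>A (\<lambda>\<eta>. f \<eta> + a * g \<eta>) N \<eta> - J (\<lambda>\<eta>. f \<eta> + a * g \<eta>)\<bar>)
        \<le> measure_pmf.expectation (q N) (\<lambda>\<eta>. \<bar>A f N \<eta> - J f\<bar>) + \<bar>a\<bar> * measure_pmf.expectation (q N) (\<lambda>\<eta>. \<bar>A g N \<eta> - J g\<bar>)"
      if "0 < N" for N
    proof -
      have int [simp]: "integrable (measure_pmf (q N)) f" for f :: "_ \<Rightarrow> real"
        using fin[OF that] by (rule integrable_measure_pmf_finite)
      have "measure_pmf.expectation (q N) (\<lambda>\<eta>. \<bar>A (\<lambda>\<eta>. f \<eta> + a * g \<eta>) N \<eta> - J (\<lambda>\<eta>. f \<eta> + a * g \<eta>)\<bar>)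
        \<le> measure_pmf.expectation (q N) (\<lambda>\<eta>. \<bar>A f N \<eta> - J f\<bar> + \<bar>a\<bar> * \<bar>A g N \<eta> - J g\<bar>)"
      proof (intro integral_mono)
        fix \<eta>
        have "A (\<lambda>\<eta>. f \<eta> + a * g \<eta>) N \<eta> - J (\<lambda>\<eta>. f \<eta> + a * g \<eta>) = (A f N \<eta> - J f) + a * (A g N \<eta> - J g)"
          unfolding A J by (simp add: algebra_simps)
        then show "\<bar>A (\<lambda>\<eta>. f \<eta> + a * g \<eta>) N \<eta> - J (\<lambda>\<eta>. f \<eta> + a * g \<eta>)\<bar> \<le> \<bar>A f N \<eta> - J f\<bar> + \<bar>a\<bar> * \<bar>A g N \<eta> - J g\<bar>"
          by (metis abs_mult abs_triangle_ineq)
      qed auto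
      then show ?thesis by simp
    qed
    have conv: "average_converges G h \<longleftrightarrow> (\<lambda>N. measure_pmf.expectation (q N) (\<lambda>\<eta>. \<bar>A h N \<eta> - J h\<bar>)) \<longlonglongrightarrow> 0" for h
      by (simp only: average_converges_def A_def J_def)
    have "(\<lambda>N. measure_pmf.expectation (q N) (\<lambda>\<eta>. \<bar>A f N \<eta> - J f\<bar>) + \<bar>a\<bar> * measure_pmf.expectation (q N) (\<lambda>\<eta>. \<bar>A g N \<eta> - J g\<bar>))
        \<longlonglongrightarrow> 0 + \<bar>a\<bar> * 0"
      using comb unfolding conv by (intro tendsto_add tendsto_mult tendsto_const) auto
    then have "average_converges G (\<lambda>\<eta>. f \<eta> + a * g \<eta>)"
      unfolding conv by (intro LIMSEQ_zero_bound[OF _ _ le]) simp_all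
    then show ?case using reg by (simp add: regular_observable_comb)
  qed
  then show ?thesis ..
qed

text \<open>The two sums differ only at sites within distance m of an end, at most 2m of them. There
  the shifted function may read sites outside the box, and its bound is all that enters.\<close>

lemma empirical_average_boundary:
  assumes A: "A \<subseteq> {- int m..int m}" "depends_only_on \<phi> A" and N: "0 < N"
    and M: "\<And>\<eta>. \<bar>\<phi> \<eta>\<bar> \<le> M" and \<Gamma>: "\<And>y. y \<in> {-1..1} \<Longrightarrow> \<bar>G y\<bar> \<le> \<Gamma>"
  shows "\<bar>empirical_average N G \<phi> \<eta> - 1 / real N * (\<Sum>x\<in>box N. G (real_of_int x / real N) * shift x \<phi> \<eta>)\<bar>
    \<le> 2 * real m * (\<Gamma> * M) / real N"
proof -
  define S where "S = {x \<in> box N. depends_only_on (shift x \<phi>) (box N)}"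
  define f where "f x = G (real_of_int x / real N) * shift x \<phi> \<eta>" for x
  have nonneg: "0 \<le> \<Gamma>" "0 \<le> M"
    using order_trans[OF abs_ge_zero \<Gamma>[of 0]] order_trans[OF abs_ge_zero M] by auto
  then have GM: "0 \<le> \<Gamma> * M" by simp
  have fb: "\<bar>f x\<bar> \<le> \<Gamma> * M" if "x \<in> box N" for x
    unfolding f_def abs_mult using \<Gamma>[OF box_scaled[OF that N]] M nonneg
    by (intro mult_mono) (auto simp: shift_def)
  have "box N - S \<subseteq> {x \<in> box N. \<not> \<bar>x\<bar> \<le> int N - int m}"
  proof
    fix x assume x: "x \<in> box N - S"
    have False if le: "\<bar>x\<bar> \<le> int N - int m"
    proof -
      have "z + x \<in> box N" if "z \<in> A" for z
      proof -
        have "z \<in> {- int m..int m}" using that A(1) by blast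
        then show ?thesis using le by (auto simp: box_def)
      qed
      then have "depends_only_on (shift x \<phi>) (box N)"
        using A(2) by (auto simp: depends_only_on_def shift_def)
      then show False using x by (simp add: S_def)
    qed
    then show "x \<in> {x \<in> box N. \<not> \<bar>x\<bar> \<le> int N - int m}" using x by auto
  qed
  then have "card (box N - S) \<le> card {x \<in> box N. \<not> \<bar>x\<bar> \<le> int N - int m}" by (intro card_mono) auto
  then have cd: "real (card (box N - S)) \<le> 2 * real m" using card_box_margin[of N m] by linarith
  have "(\<Sum>x\<in>box N. f x) = (\<Sum>x\<in>S. f x) + (\<Sum>x\<in>box N - S. f x)"
    by (rule sum.subset_diff[of S, THEN trans]) (auto simp: S_def)
  then have "empirical_average N G \<phi> \<eta> - 1 / real N * (\<Sum>x\<in>box N. f x) = - (\<Sum>x\<in>box N - S. f x) / real N"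
    by (simp add: empirical_average_def f_def S_def add_divide_distrib)
  then have "\<bar>empirical_average N G \<phi> \<eta> - 1 / real N * (\<Sum>x\<in>box N. f x)\<bar> = \<bar>\<Sum>x\<in>box N - S. f x\<bar> / real N"
    by simp
  also have "\<dots> \<le> (\<Sum>x\<in>box N - S. \<bar>f x\<bar>) / real N" by (intro divide_right_mono sum_abs) auto
  also have "\<dots> \<le> real (card (box N - S)) * (\<Gamma> * M) / real N"
    using fb by (intro divide_right_mono sum_bounded_above) auto
  also have "\<dots> \<le> 2 * real m * (\<Gamma> * M) / real N"
    using cd GM by (intro divide_right_mono mult_right_mono) auto
  finally show ?thesis by (simp add: f_def)
qed

section \<open>The law and the joint measurability of the process\<close>

lemma finite_configs: "finite (configs N)"
  unfolding configs_def by (intro finite_PiE) auto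

text \<open>The generating fibres are measurable, those over points outside \<open>S\<close> being
  empty.\<close>

lemma subalgebra_natural_filtration:
  assumes "\<And>u. 0 \<le> u \<Longrightarrow> X u \<in> measurable M (count_space S)"
  shows "subalgebra M (natural_filtration M X s)"
proof -
  have gen: "{X u -` {a} \<inter> space M | u a. 0 \<le> u \<and> u \<le> s} \<subseteq> sets M"
  proof clarify
    fix u a assume u: "0 \<le> u" "u \<le> s"
    show "X u -` {a} \<inter> space M \<in> sets M"
    proof (cases "a \<in> S")
      case True
      then show ?thesis by (intro measurable_sets[OF assms[OF u(1)]]) auto
    next
      case False
      then have "X u -` {a} \<inter> space M = {}" using measurable_space[OF assms[OF u(1)]] by auto
      then show ?thesis by simp
    qed
  qed
  have pow: "{X u -` {a} \<inter> space M | u a. 0 \<le> u \<and> u \<le> s} \<subseteq> Pow (space M)" by auto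
  show ?thesis
    unfolding subalgebra_def natural_filtration_def
    using sets.sigma_sets_subset[OF gen] by (simp only: space_measure_of[OF pow] sets_measure_of[OF pow] simp_thms)
qed

text \<open>The law at time s is \<open>P 0 s x0\<close>: average the conditional probabilities
  given time 0, where the process is almost surely at \<open>x0\<close>. The derivative is then the
  forward equation of the transition function.\<close>

lemma markov_process_law:
  fixes X :: "real \<Rightarrow> 'w \<Rightarrow> 'a"
  assumes mp: "markov_process S L x0 M X" and S: "finite S" "x0 \<in> S"
  obtains q :: "real \<Rightarrow> 'a pmf" where
    "\<And>s. 0 \<le> s \<Longrightarrow> set_pmf (q s) \<subseteq> S"
    "\<And>s f. 0 \<le> s \<Longrightarrow> (\<integral>\<omega>. f (X s \<omega>) \<partial>M) = measure_pmf.expectation (q s) (f :: 'a \<Rightarrow> real)"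
    "\<And>s f. 0 \<le> s \<Longrightarrow> ((\<lambda>r. measure_pmf.expectation (q r) f) has_real_derivative
        measure_pmf.expectation (q s) (L s f)) (at s within {0..})"
proof -
  have M: "prob_space M" and X: "\<And>s. 0 \<le> s \<Longrightarrow> X s \<in> measurable M (count_space S)"
    and X0: "AE \<omega> in M. X 0 \<omega> = x0"
    using mp by (auto simp: markov_process_def)
  obtain P where P: "transition_function S L P"
    and cond: "\<And>s t y. y \<in> S \<Longrightarrow> 0 \<le> s \<Longrightarrow> s \<le> t \<Longrightarrow>
       AE \<omega> in M. real_cond_exp M (natural_filtration M X s) (\<lambda>\<omega>. indicator {y} (X t \<omega>)) \<omega> = pmf (P s t (X s \<omega>)) y"
    using mp by (auto simp: markov_process_def)
  interpret prob_space M by (rule M)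
  have P_S: "set_pmf (P 0 s x0) \<subseteq> S" if "0 \<le> s" for s
    using P S(2) that by (auto simp: transition_function_def)
  have XS: "X s \<omega> \<in> S" if "\<omega> \<in> space M" "0 \<le> s" for s \<omega>
    using measurable_space[OF X[OF that(2)] that(1)] by simp
  have comp: "(\<lambda>\<omega>. g (X s \<omega>)) \<in> borel_measurable M" if "0 \<le> s" for s and g :: "'a \<Rightarrow> real"
    by (rule measurable_compose[OF X[OF that]]) simp
  have point: "(\<integral>\<omega>. indicator {y} (X s \<omega>) \<partial>M) = pmf (P 0 s x0) y" if y: "y \<in> S" and s: "0 \<le> s" for s y
  proof -
    interpret finite_measure_subalgebra M "natural_filtration M X 0"
      by unfold_locales (rule subalgebra_natural_filtration[OF X])
    have "integrable M (\<lambda>\<omega>. indicator {y} (X s \<omega>) :: real)"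
      by (rule integrable_const_bound[where B = 1]) (use comp[OF s] in auto)
    then have "(\<integral>\<omega>. indicator {y} (X s \<omega>) \<partial>M) =
        (\<integral>\<omega>. real_cond_exp M (natural_filtration M X 0) (\<lambda>\<omega>. indicator {y} (X s \<omega>)) \<omega> \<partial>M)"
      by (rule real_cond_exp_int(2)[symmetric])
    also have "\<dots> = (\<integral>\<omega>. pmf (P 0 s x0) y \<partial>M)"
    proof (rule integral_cong_AE)
      show "AE \<omega> in M. real_cond_exp M (natural_filtration M X 0) (\<lambda>\<omega>. indicator {y} (X s \<omega>)) \<omega> = pmf (P 0 s x0) y"
        using cond[OF y order_refl s] X0 by eventually_elim simp
    qed auto
    also have "\<dots> = pmf (P 0 s x0) y" using prob_space by simp
    finally show ?thesis .
  qed
  show thesis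
  proof (rule that)
    show "set_pmf (P 0 s x0) \<subseteq> S" if "0 \<le> s" for s by (rule P_S[OF that])
  next
    fix s :: real and f :: "'a \<Rightarrow> real" assume s: "0 \<le> s"
    have int: "integrable M (\<lambda>\<omega>. indicator {y} (X s \<omega>) * f y)" for y
      by (intro integrable_mult_left integrable_const_bound[where B = 1]) (use comp[OF s] in auto)
    have "(\<integral>\<omega>. f (X s \<omega>) \<partial>M) = (\<integral>\<omega>. (\<Sum>y\<in>S. indicator {y} (X s \<omega>) * f y) \<partial>M)"
    proof (rule Bochner_Integration.integral_cong)
      fix \<omega> assume "\<omega> \<in> space M"
      then have "X s \<omega> \<in> S" using XS s by blast
      then show "f (X s \<omega>) = (\<Sum>y\<in>S. indicator {y} (X s \<omega>) * f y)"
        using S(1) by (simp add: indicator_def if_distrib cong: if_cong)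
    qed simp
    also have "\<dots> = (\<Sum>y\<in>S. (\<integral>\<omega>. indicator {y} (X s \<omega>) * f y \<partial>M))"
      by (rule Bochner_Integration.integral_sum) (rule int)
    also have "\<dots> = (\<Sum>y\<in>S. f y * pmf (P 0 s x0) y)"
      using point s by (intro sum.cong) auto
    also have "\<dots> = measure_pmf.expectation (P 0 s x0) f"
      by (rule integral_measure_pmf_real[symmetric]) (use S(1) P_S[OF s] in auto)
    finally show "(\<integral>\<omega>. f (X s \<omega>) \<partial>M) = measure_pmf.expectation (P 0 s x0) f" .
  next
    fix s :: real and f :: "'a \<Rightarrow> real" assume "0 \<le> s"
    then show "((\<lambda>r. measure_pmf.expectation (P 0 r x0) f) has_real_derivative
        measure_pmf.expectation (P 0 s x0) (L s f)) (at s within {0..})"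
      using P S(2) unfolding transition_function_def by blast
  qed
qed

text \<open>The grid point is strictly to the right of s, as right-continuity in terms of
  \<open>at_right\<close> demands, and at distance at most 1/(n + 1).\<close>

lemma grid_from_right:
  fixes s :: real
  assumes "0 \<le> s"
  shows "filterlim (\<lambda>n. (real (nat \<lfloor>real (Suc n) * s\<rfloor>) + 1) / real (Suc n)) (at_right s) sequentially"
proof (rule tendsto_imp_filterlim_at_right)
  have bounds: "s < (real (nat \<lfloor>real (Suc n) * s\<rfloor>) + 1) / real (Suc n)"
    "(real (nat \<lfloor>real (Suc n) * s\<rfloor>) + 1) / real (Suc n) \<le> s + 1 / real (Suc n)" for n
  proof -
    have k: "real (nat \<lfloor>real (Suc n) * s\<rfloor>) = real_of_int \<lfloor>real (Suc n) * s\<rfloor>" using assms by simp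
    have "real (Suc n) * s < real_of_int \<lfloor>real (Suc n) * s\<rfloor> + 1" by linarith
    then show "s < (real (nat \<lfloor>real (Suc n) * s\<rfloor>) + 1) / real (Suc n)"
      unfolding k by (simp add: pos_less_divide_eq mult.commute)
    have "real_of_int \<lfloor>real (Suc n) * s\<rfloor> + 1 \<le> (s + 1 / real (Suc n)) * real (Suc n)"
    proof -
      have "(s + 1 / real (Suc n)) * real (Suc n) = real (Suc n) * s + 1" by (simp add: field_simps)
      then show ?thesis using of_int_floor_le[of "real (Suc n) * s"] by linarith
    qed
    then show "(real (nat \<lfloor>real (Suc n) * s\<rfloor>) + 1) / real (Suc n) \<le> s + 1 / real (Suc n)"
      unfolding k by (subst pos_divide_le_eq) auto
  qed
  have "(\<lambda>n. s + 1 / real (Suc n)) \<longlonglongrightarrow> s + 0"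
    by (intro tendsto_add tendsto_const) (use LIMSEQ_inverse_real_of_nat in \<open>simp add: inverse_eq_divide\<close>)
  then have up: "(\<lambda>n. s + 1 / real (Suc n)) \<longlonglongrightarrow> s" by simp
  show "(\<lambda>n. (real (nat \<lfloor>real (Suc n) * s\<rfloor>) + 1) / real (Suc n)) \<longlonglongrightarrow> s"
  proof (rule tendsto_sandwich[OF _ _ tendsto_const up])
    show "\<forall>\<^sub>F n in sequentially. s \<le> (real (nat \<lfloor>real (Suc n) * s\<rfloor>) + 1) / real (Suc n)"
      by (intro always_eventually allI less_imp_le bounds(1))
    show "\<forall>\<^sub>F n in sequentially. (real (nat \<lfloor>real (Suc n) * s\<rfloor>) + 1) / real (Suc n) \<le> s + 1 / real (Suc n)"
      by (intro always_eventually allI bounds(2))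
  qed
  show "\<forall>\<^sub>F n in sequentially. s < (real (nat \<lfloor>real (Suc n) * s\<rfloor>) + 1) / real (Suc n)"
    by (intro always_eventually allI bounds(1))
qed

text \<open>Reading the path at the next grid point involves countably many times only, hence is
  jointly measurable. By right-continuity in the discrete topology these readings are eventually
  constant in n.\<close>

lemma markov_process_joint_measurable:
  fixes X :: "real \<Rightarrow> 'w \<Rightarrow> 'a"
  assumes mp: "markov_process S L x0 M X"
  shows "(\<lambda>(s, \<omega>). indicator {0..} s * indicator {y} (X s \<omega>) :: real) \<in> borel_measurable (lborel \<Otimes>\<^sub>M M)"
proof -
  have X: "\<And>s. 0 \<le> s \<Longrightarrow> X s \<in> measurable M (count_space S)"
    and rc: "\<And>\<omega> s. \<omega> \<in> space M \<Longrightarrow> 0 \<le> s \<Longrightarrow> \<forall>\<^sub>F r in at_right s. X r \<omega> = X s \<omega>"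
    using mp by (auto simp: markov_process_def)
  define a where "a n s = (real (nat \<lfloor>real (Suc n) * s\<rfloor>) + 1) / real (Suc n)" for n s
  define f where "f n p = (indicator {0..} (fst p) * indicator {y} (X (a n (fst p)) (snd p)) :: real)" for n and p :: "real \<times> 'w"
  have "(\<lambda>p. indicator {0..} (fst p) * indicator {y} (X (fst p) (snd p)) :: real) \<in> borel_measurable (lborel \<Otimes>\<^sub>M M)"
  proof (rule borel_measurable_LIMSEQ_real)
    fix n
    have "(\<lambda>\<omega>. indicator {y} (X ((real k + 1) / real (Suc n)) \<omega>) :: real) \<in> borel_measurable M" for k :: nat
      by (rule measurable_compose[OF X]) auto
    then have "(\<lambda>p. indicator {y} (X ((real k + 1) / real (Suc n)) (snd p)) :: real) \<in> borel_measurable (lborel \<Otimes>\<^sub>M M)" for k :: nat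
      by (rule measurable_compose[OF measurable_snd])
    moreover have "(\<lambda>p. nat \<lfloor>real (Suc n) * fst p\<rfloor>) \<in> measurable (lborel \<Otimes>\<^sub>M M) (count_space UNIV)"
      by measurable
    ultimately have "(\<lambda>p. indicator {y} (X ((real (nat \<lfloor>real (Suc n) * fst p\<rfloor>) + 1) / real (Suc n)) (snd p)) :: real)
        \<in> borel_measurable (lborel \<Otimes>\<^sub>M M)"
      by (rule measurable_compose_countable)
    then show "f n \<in> borel_measurable (lborel \<Otimes>\<^sub>M M)"
      unfolding f_def[abs_def] a_def by measurable
  next
    fix p :: "real \<times> 'w" assume p: "p \<in> space (lborel \<Otimes>\<^sub>M M)"
    then have w: "snd p \<in> space M" by (auto simp: space_pair_measure)
    show "(\<lambda>n. f n p) \<longlonglongrightarrow> indicator {0..} (fst p) * indicator {y} (X (fst p) (snd p))"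
    proof (cases "0 \<le> fst p")
      case True
      have "\<forall>\<^sub>F n in sequentially. X (a n (fst p)) (snd p) = X (fst p) (snd p)"
        using filterlim_iff[THEN iffD1, OF grid_from_right[OF True], rule_format, OF rc[OF w True]]
        by (simp add: a_def)
      then have "\<forall>\<^sub>F n in sequentially. f n p = indicator {0..} (fst p) * indicator {y} (X (fst p) (snd p))"
        by eventually_elim (simp add: f_def)
      then show ?thesis by (rule tendsto_eventually)
    qed (simp add: f_def)
  qed
  then show ?thesis by (simp add: case_prod_beta')
qed

lemma empirical_average_abs_le:
  assumes N: "0 < N" and M: "\<And>\<eta>. \<bar>\<phi> \<eta>\<bar> \<le> M" and \<Gamma>: "\<And>y. y \<in> {-1..1} \<Longrightarrow> \<bar>G y\<bar> \<le> \<Gamma>"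
  shows "\<bar>empirical_average N G \<phi> \<eta>\<bar> \<le> 3 * (\<Gamma> * M)"
proof -
  define S where "S = {x \<in> box N. depends_only_on (shift x \<phi>) (box N)}"
  have nonneg: "0 \<le> \<Gamma>" "0 \<le> M"
    using order_trans[OF abs_ge_zero \<Gamma>[of 0]] order_trans[OF abs_ge_zero M] by auto
  have "\<bar>\<Sum>x\<in>S. G (real_of_int x / real N) * shift x \<phi> \<eta>\<bar> \<le> (\<Sum>x\<in>S. \<Gamma> * M)"
    using \<Gamma>[OF box_scaled[OF _ N]] M nonneg
    by (intro order_trans[OF sum_abs] sum_mono, unfold abs_mult, intro mult_mono)
      (auto simp: S_def shift_def)
  also have "\<dots> \<le> real (card (box N)) * (\<Gamma> * M)"
    using nonneg card_mono[of "box N" S] by (auto simp: S_def intro!: mult_right_mono)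
  also have "\<dots> \<le> (3 * real N) * (\<Gamma> * M)"
    using nonneg N by (intro mult_right_mono) (auto simp: card_box)
  finally have "\<bar>\<Sum>x\<in>S. G (real_of_int x / real N) * shift x \<phi> \<eta>\<bar> / real N \<le> (3 * real N) * (\<Gamma> * M) / real N"
    by (rule divide_right_mono) simp
  then show ?thesis using N by (simp add: empirical_average_def S_def)
qed

section \<open>The hydrodynamic limit\<close>

theorem theorem3p1:
  fixes \<rho>m \<rho>p \<rho>m' \<rho>p' :: "real \<Rightarrow> real"
    and \<alpha> t :: real
    and G :: "real \<Rightarrow> real"
    and \<phi> :: "config \<Rightarrow> real"
    and \<eta>0 :: "nat \<Rightarrow> config"
    and M :: "nat \<Rightarrow> 'w measure"
    and X :: "nat \<Rightarrow> real \<Rightarrow> 'w \<Rightarrow> config"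
  assumes "\<And>s. 0 \<le> s \<Longrightarrow> 0 < \<rho>m s \<and> \<rho>m s < 1"
    and "\<And>s. 0 \<le> s \<Longrightarrow> 0 < \<rho>p s \<and> \<rho>p s < 1"
    and "\<And>s. 0 \<le> s \<Longrightarrow> (\<rho>m has_real_derivative \<rho>m' s) (at s within {0..})"
    and "\<And>s. 0 \<le> s \<Longrightarrow> (\<rho>p has_real_derivative \<rho>p' s) (at s within {0..})"
    and "bounded (\<rho>m' ` {0..})"
    and "bounded (\<rho>p' ` {0..})"
    and "0 < \<alpha>"
    and "0 < t"
    and "\<And>N. 0 < N \<Longrightarrow> \<eta>0 N \<in> configs N"
    and "\<And>N. 0 < N \<Longrightarrow> markov_process (configs N) (gen \<alpha> \<rho>m \<rho>p N) (\<eta>0 N) (M N) (X N)"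
    and "local_function \<phi>"
    and "continuous_on {-1..1} G"
  shows "(\<lambda>N. prob_space.expectation (M N) (\<lambda>\<omega>.
            LBINT s:{0..t}.
              \<bar>empirical_average N G \<phi> (X N s \<omega>)
               - (LBINT y:{-1..1}. G y * bernoulli_mean \<phi> (rho_bar \<rho>m \<rho>p y s))\<bar>))
         \<longlonglongrightarrow> 0"
proof -
  note rm = assms(1) and rp = assms(2) and rm' = assms(3) and rp' = assms(4)
    and mp = assms(10) and loc = assms(11) and G = assms(12)
  have reg: "regular_observable \<phi>" by (rule regular_observable_local[OF loc])
  obtain D1 where D1: "\<forall>s\<in>{0..}. \<bar>\<rho>m' s\<bar> \<le> D1" using assms(5) by (auto simp: bounded_iff)
  obtain D2 where D2: "\<forall>s\<in>{0..}. \<bar>\<rho>p' s\<bar> \<le> D2" using assms(6) by (auto simp: bounded_iff)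
  define D where "D = max D1 D2"
  obtain A where A: "finite A" "depends_only_on \<phi> A" using loc by (auto simp: local_function_def)
  obtain m :: nat where m: "A \<subseteq> {- int m..int m}"
  proof (rule that)
    show "A \<subseteq> {- int (\<Sum>z\<in>A. nat \<bar>z\<bar>)..int (\<Sum>z\<in>A. nat \<bar>z\<bar>)}"
    proof
      fix z assume "z \<in> A"
      then have "nat \<bar>z\<bar> \<le> (\<Sum>z\<in>A. nat \<bar>z\<bar>)" using A(1) by (intro member_le_sum) auto
      then show "z \<in> {- int (\<Sum>z\<in>A. nat \<bar>z\<bar>)..int (\<Sum>z\<in>A. nat \<bar>z\<bar>)}" by (simp only: atLeastAtMost_iff) linarith
    qed
  qed
  obtain B where B: "\<And>\<eta>. \<bar>\<phi> \<eta>\<bar> \<le> B" using reg by (auto simp: regular_observable_def)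
  have "\<exists>\<Gamma>. \<forall>y\<in>{-1..1}. \<bar>G y\<bar> \<le> \<Gamma>"
    using compact_imp_bounded[OF compact_continuous_image[OF G]] by (auto simp: bounded_iff)
  then obtain \<Gamma> where \<Gamma>: "\<And>y. y \<in> {-1..1} \<Longrightarrow> \<bar>G y\<bar> \<le> \<Gamma>" by blast
  have nonneg: "0 \<le> \<Gamma>" "0 \<le> B"
    using order_trans[OF abs_ge_zero \<Gamma>[of 0]] order_trans[OF abs_ge_zero B] by auto

  \<comment> \<open>The deterministic limit as a function of time\<close>
  define c where "c s = (LBINT y:{-1..1}. G y * bernoulli_mean \<phi> (rho_bar \<rho>m \<rho>p y s))" for s
  \<comment> \<open>The Riemann sums are continuous in time and uniformly bounded, so
    \<open>c\<close> inherits measurability and a bound from them. Time is restricted to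
    \<open>{0..t}\<close>, since the densities are controlled only at nonnegative times.\<close>
  define R where "R N s = 1 / real N * (\<Sum>x\<in>box N. G (real_of_int x / real N) *
      bernoulli_mean \<phi> (rho_bar \<rho>m \<rho>p (real_of_int x / real N) s))" for N s
  have R_c: "(\<lambda>N. R N s) \<longlonglongrightarrow> c s" if "0 \<le> s" for s
    unfolding R_def c_def
    using rm[OF that] rp[OF that]
    by (intro riemann_sum_box[of "\<lambda>y. G y * bernoulli_mean \<phi> (rho_bar \<rho>m \<rho>p y s)"]
        continuous_on_mean_rho_bar[where \<rho>m = \<rho>m and \<rho>p = \<rho>p and s = s, OF reg G]) auto
  have R_bound: "\<bar>R (Suc n) s\<bar> \<le> 3 * (\<Gamma> * B)" for n s
  proof -
    have "\<bar>\<Sum>x\<in>box (Suc n). G (real_of_int x / real (Suc n)) * bernoulli_mean \<phi> (rho_bar \<rho>m \<rho>p (real_of_int x / real (Suc n)) s)\<bar>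
        \<le> real (card (box (Suc n))) * (\<Gamma> * B)"
      using \<Gamma>[OF box_scaled[of _ "Suc n"]] bernoulli_mean_abs_le[OF reg B] nonneg
      by (intro order_trans[OF sum_abs] sum_bounded_above, unfold abs_mult, intro mult_mono) (auto simp del: of_nat_Suc)
    also have "\<dots> \<le> (3 * real (Suc n)) * (\<Gamma> * B)"
      using nonneg by (intro mult_right_mono) (auto simp: card_box)
    finally have "\<bar>\<Sum>x\<in>box (Suc n). G (real_of_int x / real (Suc n)) * bernoulli_mean \<phi> (rho_bar \<rho>m \<rho>p (real_of_int x / real (Suc n)) s)\<bar> / real (Suc n)
        \<le> (3 * real (Suc n)) * (\<Gamma> * B) / real (Suc n)"
      by (rule divide_right_mono) simp
    then show ?thesis by (simp add: R_def del: of_nat_Suc)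
  qed
  have c_bound: "\<bar>c s\<bar> \<le> 3 * (\<Gamma> * B)" if "0 \<le> s" for s
    by (rule LIMSEQ_le_const2[OF tendsto_rabs[OF R_c[OF that, THEN LIMSEQ_Suc]]]) (use R_bound in auto)
  have cont_rho: "continuous_on {0..} \<rho>m" "continuous_on {0..} \<rho>p"
    by (rule DERIV_continuous_on[of _ _ \<rho>m'], simp add: rm', rule DERIV_continuous_on[of _ _ \<rho>p'], simp add: rp')
  have R_meas: "(\<lambda>s. indicator {0..t} s * R (Suc n) s) \<in> borel_measurable borel" for n
  proof -
    have "continuous_on {0..t} (R (Suc n))"
      unfolding R_def[abs_def]
    proof (intro continuous_on_mult continuous_on_const continuous_on_sum)
      fix x assume x: "x \<in> box (Suc n)"
      show "continuous_on {0..t} (\<lambda>s. bernoulli_mean \<phi> (rho_bar \<rho>m \<rho>p (real_of_int x / real (Suc n)) s))"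
      proof (rule continuous_on_compose2[of "{0..1}" "bernoulli_mean \<phi>"])
        show "continuous_on {0..1} (bernoulli_mean \<phi>)" using reg by (simp add: regular_observable_def)
        show "continuous_on {0..t} (\<lambda>s. rho_bar \<rho>m \<rho>p (real_of_int x / real (Suc n)) s)"
          unfolding rho_bar_def
          by (intro continuous_intros continuous_on_subset[OF cont_rho(1)] continuous_on_subset[OF cont_rho(2)]) auto
        show "(\<lambda>s. rho_bar \<rho>m \<rho>p (real_of_int x / real (Suc n)) s) ` {0..t} \<subseteq> {0..1}"
        proof clarify
          fix s assume "s \<in> {0..t}"
          then have "0 \<le> s" by simp
          then show "rho_bar \<rho>m \<rho>p (real_of_int x / real (Suc n)) s \<in> {0..1}"
            using rho_bar_bounds[OF box_scaled[OF x], of \<rho>m s \<rho>p] rm[of s] rp[of s] by simp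
        qed
      qed
    qed
    from borel_measurable_continuous_on_indicator[OF _ this] show ?thesis by simp
  qed
  have c_meas: "(\<lambda>s. indicator {0..t} s * c s) \<in> borel_measurable borel"
  proof (rule borel_measurable_LIMSEQ_real[OF _ R_meas])
    fix s :: real
    show "(\<lambda>n. indicator {0..t} s * R (Suc n) s) \<longlonglongrightarrow> indicator {0..t} s * c s"
    proof (cases "s \<in> {0..t}")
      case True
      then have "0 \<le> s" by simp
      then show ?thesis by (intro tendsto_mult tendsto_const R_c[THEN LIMSEQ_Suc])
    qed simp
  qed

  \<comment> \<open>The one-time laws and convergence at a fixed positive time\<close>
  define law where "law N q \<longleftrightarrow> (\<forall>s\<ge>0. set_pmf (q s) \<subseteq> configs N \<and>
      (\<forall>f. (\<integral>\<omega>. f (X N s \<omega>) \<partial>M N) = measure_pmf.expectation (q s) (f :: config \<Rightarrow> real)) \<and>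
      (\<forall>f. ((\<lambda>r. measure_pmf.expectation (q r) f) has_real_derivative
        measure_pmf.expectation (q s) (gen \<alpha> \<rho>m \<rho>p N s f)) (at s within {0..})))" for N q
  define q where "q N = (SOME q. law N q)" for N
  have q: "law N (q N)" if N: "0 < N" for N
  proof -
    have "\<exists>q'. law N q'"
    proof (rule markov_process_law[OF mp[OF N] finite_configs assms(9)[OF N]])
      fix q'
      assume "\<And>s. 0 \<le> s \<Longrightarrow> set_pmf (q' s) \<subseteq> configs N"
        and "\<And>s f. 0 \<le> s \<Longrightarrow> (\<integral>\<omega>. f (X N s \<omega>) \<partial>M N) = measure_pmf.expectation (q' s) (f :: config \<Rightarrow> real)"
        and "\<And>s f. 0 \<le> s \<Longrightarrow> ((\<lambda>r. measure_pmf.expectation (q' r) f) has_real_derivative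
          measure_pmf.expectation (q' s) (gen \<alpha> \<rho>m \<rho>p N s f)) (at s within {0..})"
      then have "law N q'" unfolding law_def by (intro allI impI conjI)
      then show ?thesis by blast
    qed
    then show ?thesis unfolding q_def by (rule someI_ex)
  qed
  have q_S: "set_pmf (q N s) \<subseteq> configs N"
    and q_law: "(\<integral>\<omega>. f (X N s \<omega>) \<partial>M N) = measure_pmf.expectation (q N s) f"
    and q_fwd: "((\<lambda>r. measure_pmf.expectation (q N r) f) has_real_derivative
        measure_pmf.expectation (q N s) (gen \<alpha> \<rho>m \<rho>p N s f)) (at s within {0..})"
    if "0 < N" "0 \<le> s" for N s and f :: "config \<Rightarrow> real"
    using q[OF that(1)] that(2) unfolding law_def by blast+
  have q_fin: "finite (set_pmf (q N s))" if "0 < N" "0 \<le> s" for N s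
    using q_S[OF that] finite_configs finite_subset by blast
  define h where "h N s = measure_pmf.expectation (q N s) (\<lambda>\<eta>. \<bar>empirical_average N G \<phi> \<eta> - c s\<bar>)" for N s
  have h_lim: "(\<lambda>N. h N s) \<longlonglongrightarrow> 0" if s: "0 < s" for s
  proof -
    interpret local_equilibrium \<rho>m \<rho>p s "\<lambda>N. q N s"
    proof
      show "0 \<le> \<rho>m s" "\<rho>m s \<le> 1" "0 \<le> \<rho>p s" "\<rho>p s \<le> 1" using rm[of s] rp[of s] s by auto
      show "finite (set_pmf (q N s))" if "0 < N" for N using q_fin that s by simp
      fix K :: nat assume K: "0 < K"
      show "\<exists>\<epsilon>. \<epsilon> \<longlonglongrightarrow> 0 \<and> (\<forall>N>0. \<forall>C\<subseteq>box N. card C \<le> K \<longrightarrow>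
        \<bar>measure_pmf.expectation (q N s) (mon C) - (\<Prod>y\<in>C. profile (\<rho>m s) (\<rho>p s) N y)\<bar> \<le> \<epsilon> N)"
      proof (intro exI conjI allI impI)
        show "(\<lambda>N. corr_err \<alpha> D K N s) \<longlonglongrightarrow> 0" by (rule corr_err_tendsto[OF assms(7) K s])
        fix N C assume N: "0 < N" and C: "C \<subseteq> box N" "card C \<le> K"
        show "\<bar>measure_pmf.expectation (q N s) (mon C) - (\<Prod>y\<in>C. profile (\<rho>m s) (\<rho>p s) N y)\<bar> \<le> corr_err \<alpha> D K N s"
        proof (rule correlation_estimate[OF N K _ _ rm' rp' _ _ q_fin[OF N] q_fwd[OF N] C less_imp_le[OF s]])
          fix s :: real assume s: "0 \<le> s"
          show "0 \<le> \<rho>m s \<and> \<rho>m s \<le> 1" "0 \<le> \<rho>p s \<and> \<rho>p s \<le> 1" using rm[OF s] rp[OF s] by auto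
          show "\<bar>\<rho>m' s\<bar> \<le> D" "\<bar>\<rho>p' s\<bar> \<le> D" using D1 D2 s unfolding D_def by (auto simp: le_max_iff_disj)
        qed
      qed
    qed
    define V where "V N \<eta> = 1 / real N * (\<Sum>x\<in>box N. G (real_of_int x / real N) * shift x \<phi> \<eta>)" for N \<eta>
    have "(\<lambda>N. measure_pmf.expectation (q N s) (\<lambda>\<eta>. \<bar>V N \<eta> - c s\<bar>)) \<longlonglongrightarrow> 0"
      using average_converges_local[OF loc G] by (simp only: average_converges_def V_def c_def)
    then have lim: "(\<lambda>N. 2 * real m * (\<Gamma> * B) / real N + measure_pmf.expectation (q N s) (\<lambda>\<eta>. \<bar>V N \<eta> - c s\<bar>)) \<longlonglongrightarrow> 0"
      by (intro tendsto_add_zero lim_const_over_n)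
    show ?thesis
    proof (rule LIMSEQ_zero_bound[OF lim])
      fix N :: nat assume N: "0 < N"
      have int [simp]: "integrable (measure_pmf (q N s)) f" for f :: "_ \<Rightarrow> real"
        using q_fin[OF N] s by (intro integrable_measure_pmf_finite) simp
      show "0 \<le> h N s" by (simp add: h_def)
      have "h N s \<le> measure_pmf.expectation (q N s) (\<lambda>\<eta>. 2 * real m * (\<Gamma> * B) / real N + \<bar>V N \<eta> - c s\<bar>)"
        unfolding h_def
      proof (rule integral_mono[OF int int])
        fix \<eta>
        show "\<bar>empirical_average N G \<phi> \<eta> - c s\<bar> \<le> 2 * real m * (\<Gamma> * B) / real N + \<bar>V N \<eta> - c s\<bar>"
          using empirical_average_boundary[where \<eta> = \<eta> and G = G and \<Gamma> = \<Gamma>, OF m A(2) N B \<Gamma>] unfolding V_def[symmetric] by linarith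
      qed
      then show "h N s \<le> 2 * real m * (\<Gamma> * B) / real N + measure_pmf.expectation (q N s) (\<lambda>\<eta>. \<bar>V N \<eta> - c s\<bar>)"
        by simp
    qed
  qed

  \<comment> \<open>Integration over time\<close>
  define f where "f N s \<omega> = indicator {0..t} s * \<bar>empirical_average N G \<phi> (X N s \<omega>) - c s\<bar>" for N s \<omega>
  \<comment> \<open>Three times \<open>\<Gamma> * B\<close> for the empirical average and as much
    for \<open>c\<close>.\<close>
  define C where "C = 6 * (\<Gamma> * B)"
  have f_bound: "\<bar>f N s \<omega>\<bar> \<le> indicator {0..t} s * C" if "0 < N" for N s \<omega>
  proof (cases "s \<in> {0..t}")
    case True
    then have "\<bar>c s\<bar> \<le> 3 * (\<Gamma> * B)" using c_bound by simp
    then show ?thesis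
      using empirical_average_abs_le[of N \<phi> B G \<Gamma> "X N s \<omega>", OF that B \<Gamma>] True by (simp add: f_def C_def)
  qed (simp add: f_def)
  have f_meas: "case_prod (f N) \<in> borel_measurable (lborel \<Otimes>\<^sub>M M N)" if N: "0 < N" for N
  proof -
    note [measurable] = markov_process_joint_measurable[OF mp[OF N]] c_meas
    have XS: "X N s \<omega> \<in> configs N" if "0 \<le> s" "\<omega> \<in> space (M N)" for s \<omega>
      using mp[OF N] that measurable_space[of "X N s" "M N" "count_space (configs N)" \<omega>] by (auto simp: markov_process_def)
    \<comment> \<open>With finitely many configurations the integrand is a finite sum of jointly
      measurable indicators times functions of time.\<close>
    have "(\<lambda>p. \<bar>(\<Sum>\<eta>\<in>configs N. (case p of (s, \<omega>) \<Rightarrow> indicator {0..} s * indicator {\<eta>} (X N s \<omega>)) * (indicator {0..t} (fst p) * empirical_average N G \<phi> \<eta>))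
        - indicator {0..t} (fst p) * c (fst p)\<bar>) \<in> borel_measurable (lborel \<Otimes>\<^sub>M M N)"
      by measurable
    moreover have "case_prod (f N) p = \<bar>(\<Sum>\<eta>\<in>configs N. (case p of (s, \<omega>) \<Rightarrow> indicator {0..} s * indicator {\<eta>} (X N s \<omega>)) * (indicator {0..t} (fst p) * empirical_average N G \<phi> \<eta>))
        - indicator {0..t} (fst p) * c (fst p)\<bar>" if p: "p \<in> space (lborel \<Otimes>\<^sub>M M N)" for p
    proof (cases "fst p \<in> {0..t}")
      case True
      then have "X N (fst p) (snd p) \<in> configs N" using p by (intro XS) (auto simp: space_pair_measure)
      then have "(\<Sum>\<eta>\<in>configs N. indicator {\<eta>} (X N (fst p) (snd p)) * empirical_average N G \<phi> \<eta>) = empirical_average N G \<phi> (X N (fst p) (snd p))"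
        using finite_configs by (simp add: indicator_def if_distrib cong: if_cong)
      then show ?thesis using True by (simp add: f_def case_prod_beta')
    qed (simp add: f_def case_prod_beta')
    ultimately show ?thesis by (simp cong: measurable_cong)
  qed
  have swap: "prob_space.expectation (M N) (\<lambda>\<omega>. LBINT s:{0..t}. \<bar>empirical_average N G \<phi> (X N s \<omega>) - c s\<bar>)
      = (\<integral>s. (\<integral>\<omega>. f N s \<omega> \<partial>M N) \<partial>lborel)" if N: "0 < N" for N
  proof -
    interpret M: prob_space "M N" using mp[OF N] by (simp add: markov_process_def)
    interpret P: pair_sigma_finite lborel "M N" by unfold_locales
    have "emeasure (lborel \<Otimes>\<^sub>M M N) ({0..t} \<times> space (M N)) < \<infinity>"
      using assms(8) by (subst M.emeasure_pair_measure_Times) (auto simp: M.emeasure_space_1)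
    then have "integrable (lborel \<Otimes>\<^sub>M M N) (\<lambda>p. indicator ({0..t} \<times> space (M N)) p * C)"
      by (intro integrable_mult_left integrable_real_indicator) auto
    then have "integrable (lborel \<Otimes>\<^sub>M M N) (case_prod (f N))"
    proof (rule Bochner_Integration.integrable_bound[OF _ f_meas[OF N]])
      have C0: "0 \<le> C" using nonneg by (simp add: C_def)
      show "AE p in lborel \<Otimes>\<^sub>M M N. norm (case_prod (f N) p) \<le> norm (indicator ({0..t} \<times> space (M N)) p * C)"
      proof (rule AE_I2)
        fix p :: "real \<times> 'w" assume "p \<in> space (lborel \<Otimes>\<^sub>M M N)"
        then have "indicator ({0..t} \<times> space (M N)) p = (indicator {0..t} (fst p) :: real)"
          by (auto simp: space_pair_measure indicator_def)
        then show "norm (case_prod (f N) p) \<le> norm (indicator ({0..t} \<times> space (M N)) p * C)"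
          using f_bound[OF N, of "fst p" "snd p"] C0 by (simp add: case_prod_beta' abs_mult)
      qed
    qed
    from P.Fubini_integral[OF this] show ?thesis
      by (simp add: f_def set_lebesgue_integral_def)
  qed
  have inner: "(\<integral>\<omega>. f N s \<omega> \<partial>M N) = indicator {0..t} s * h N s" if N: "0 < N" for N s
  proof (cases "s \<in> {0..t}")
    case True
    then show ?thesis
      using q_law[OF N, of s "\<lambda>\<eta>. \<bar>empirical_average N G \<phi> \<eta> - c s\<bar>"] by (simp add: f_def h_def)
  qed (simp add: f_def)
  \<comment> \<open>Indexing by \<open>Suc n\<close> avoids N = 0, for which no process is
    given.\<close>
  have "(\<lambda>n. \<integral>s. (\<integral>\<omega>. f (Suc n) s \<omega> \<partial>M (Suc n)) \<partial>lborel) \<longlonglongrightarrow> (\<integral>s. 0 \<partial>(lborel :: real measure))"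
  proof (rule integral_dominated_convergence[where w = "\<lambda>s. indicator {0..t} s * C"])
    fix n
    interpret M: prob_space "M (Suc n)" using mp[of "Suc n"] by (simp add: markov_process_def)
    show "(\<lambda>s. \<integral>\<omega>. f (Suc n) s \<omega> \<partial>M (Suc n)) \<in> borel_measurable lborel"
      by (rule M.borel_measurable_lebesgue_integral) (rule f_meas, simp)
    have "\<bar>\<integral>\<omega>. f (Suc n) s \<omega> \<partial>M (Suc n)\<bar> \<le> indicator {0..t} s * C" for s
    proof -
      have "0 \<le> indicator {0..t} s * C" using nonneg by (simp add: C_def)
      have "(\<integral>\<omega>. \<bar>f (Suc n) s \<omega>\<bar> \<partial>M (Suc n)) \<le> (\<integral>\<omega>. indicator {0..t} s * C \<partial>M (Suc n))"
        using f_bound[of "Suc n"] \<open>0 \<le> indicator {0..t} s * C\<close> by (intro integral_mono') auto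
      then show ?thesis by (intro order_trans[OF integral_abs_bound]) (simp add: M.prob_space)
    qed
    then show "AE s in lborel. norm (\<integral>\<omega>. f (Suc n) s \<omega> \<partial>M (Suc n)) \<le> indicator {0..t} s * C" by simp
  next
    show "integrable lborel (\<lambda>s. indicator {0..t} s * C)"
      by (intro integrable_mult_left integrable_real_indicator) (auto simp: emeasure_lborel_Icc_eq)
    \<comment> \<open>At time 0 the configuration is arbitrary and convergence may fail; this single
      time is a null set.\<close>
    have "AE s in lborel. s \<noteq> (0 :: real)" by (rule AE_lborel_singleton)
    then show "AE s in lborel. (\<lambda>n. \<integral>\<omega>. f (Suc n) s \<omega> \<partial>M (Suc n)) \<longlonglongrightarrow> 0"
    proof eventually_elim
      case (elim s)
      show ?case
      proof (cases "s \<in> {0..t}")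
        case True
        then have "0 < s" using elim by simp
        then show ?thesis using h_lim[THEN LIMSEQ_Suc] True by (simp add: inner)
      qed (simp add: inner)
    qed
  qed simp
  then have "(\<lambda>n. prob_space.expectation (M (Suc n)) (\<lambda>\<omega>. LBINT s:{0..t}. \<bar>empirical_average (Suc n) G \<phi> (X (Suc n) s \<omega>) - c s\<bar>)) \<longlonglongrightarrow> 0"
    by (simp add: swap)
  then have "(\<lambda>N. prob_space.expectation (M N) (\<lambda>\<omega>. LBINT s:{0..t}. \<bar>empirical_average N G \<phi> (X N s \<omega>) - c s\<bar>)) \<longlonglongrightarrow> 0"
    by (rule LIMSEQ_imp_Suc)
  then show ?thesis by (simp only: c_def)
qed

end
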